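(* Suppose $\mathcal{G}$ is a directed graph with edge lengths $\ell$ satisfying assumptions (G1), (G2), (G3) (listed in the context), and fix a vertex $v\in V$. Let $c:\mathcal{E}\to\mathbb{R}$ be a cost on the edges of $\mathcal{G}$. Then there exists a constant $\Lambda(c)\in\mathbb{R}$ such that $$\frac1T\int_{\mathcal{P}_v}c(p)\,d\mu_T=\frac{1}{\#\mathcal{P}_v(T)}\sum_{p\in\mathcal{P}_v(T)}\frac{c(p)}{T}\longrightarrow\Lambda(c)\qquad\text{as }T\to\infty .$$ If $c$ is positive ($c(p)\ge0$ for all paths $p$ in $\mathcal{G}$) and is not identically $0$, then $\Lambda(c)>0$.
   Context: $\mathcal{G}$ is a directed graph with countable vertex set $V$ (every vertex being incident to some edge) and countable edge set $\mathcal{E}$; each edge $e$ carries a length $\ell(e)>0$. The length of a path is the sum of the lengths of its edges. Assumptions: (G1) for all $\sigma>0$, $\sum_{e\in\mathcal{E}}e^{-\sigma\ell(e)}<\infty$; (G2) there is a constant $C>0$ such that for all $e,e'\in\mathcal{E}$ there is a path in $\mathcal{G}$ of length less than $C+\ell(e)+\ell(e')$ which starts with $e$ and ends with $e'$; (G3) there does not exist $d>0$ such that $\{\ell(p):p\text{ is a closed path in }\mathcal{G}\}\subset d\mathbb{N}$. A cost is a non-zero function $c:\mathcal{E}\to\mathbb{R}$ for which there is $C>0$ with $|c(e)|\le C\ell(e)$ for all $e\in\mathcal{E}$; it extends to paths by summing over the edges of the path. $\mathcal{P}_v$ is the set of (finite) paths in $\mathcal{G}$ starting at the vertex $v$, $\mathcal{P}_v(T)=\{p\in\mathcal{P}_v:\ell(p)<T\}$,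 and $\mu_T$ is the uniform counting probability measure on $\mathcal{P}_v(T)$: $\mu_T(E)=\#(E\cap\mathcal{P}_v(T))/\#\mathcal{P}_v(T)$ for $E\subset\mathcal{P}_v$. *)

theory Defs
  imports "HOL-Analysis.Analysis" "Graph_Theory.Arc_Walk" "Graph_Theory.Weighted_Graph"
begin

text \<open>
  Graphs may have loops and parallel edges. Paths are the arc walks of Graph_Theory: repetitions
  of edges and vertices are allowed, and the empty walk at a vertex is a path. The total weight
  \<^const>\<open>wf_digraph.awalk_cost\<close> of a path serves both for its length and for its cost.
\<close>

locale length_digraph = wf_digraph G for G :: "('a, 'b) pre_digraph" +
  fixes len :: "'b \<Rightarrow> real"
  assumes countable_verts: "countable (verts G)"
    and countable_arcs: "countable (arcs G)"
    and incident_arc: "u \<in> verts G \<Longrightarrow> \<exists>e\<in>arcs G. tail G e = u \<or> head G e = u"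
    and len_pos: "e \<in> arcs G \<Longrightarrow> 0 < len e"

definition G1 :: "('a, 'b) pre_digraph \<Rightarrow> ('b \<Rightarrow> real) \<Rightarrow> bool" where
  "G1 G len \<longleftrightarrow> (\<forall>\<sigma>>0. (\<lambda>e. exp (- \<sigma> * len e)) summable_on arcs G)"

definition G2 :: "('a, 'b) pre_digraph \<Rightarrow> ('b \<Rightarrow> real) \<Rightarrow> bool" where
  "G2 G len \<longleftrightarrow> (\<exists>C>0. \<forall>e\<in>arcs G. \<forall>e'\<in>arcs G.
     \<exists>u p w. pre_digraph.awalk G u p w \<and> p \<noteq> [] \<and> hd p = e \<and> last p = e' \<and>
       wf_digraph.awalk_cost len p < C + len e + len e')"

definition G3 :: "('a, 'b) pre_digraph \<Rightarrow> ('b \<Rightarrow> real) \<Rightarrow> bool" where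
  "G3 G len \<longleftrightarrow> \<not> (\<exists>d>0. {wf_digraph.awalk_cost len p | p. wf_digraph.closed_w G p}
     \<subseteq> {d * real n | n. True})"

definition is_cost :: "('a, 'b) pre_digraph \<Rightarrow> ('b \<Rightarrow> real) \<Rightarrow> ('b \<Rightarrow> real) \<Rightarrow> bool" where
  "is_cost G len c \<longleftrightarrow> (\<exists>e\<in>arcs G. c e \<noteq> 0) \<and> (\<exists>C>0. \<forall>e\<in>arcs G. \<bar>c e\<bar> \<le> C * len e)"

definition paths_from :: "('a, 'b) pre_digraph \<Rightarrow> 'a \<Rightarrow> 'b awalk set" where
  "paths_from G v = {p. \<exists>w. pre_digraph.awalk G v p w}"

definition paths_from_less ::
    "('a, 'b) pre_digraph \<Rightarrow> ('b \<Rightarrow> real) \<Rightarrow> 'a \<Rightarrow> real \<Rightarrow> 'b awalk set" where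
  "paths_from_less G len v T = {p \<in> paths_from G v. wf_digraph.awalk_cost len p < T}"

definition path_measure ::
    "('a, 'b) pre_digraph \<Rightarrow> ('b \<Rightarrow> real) \<Rightarrow> 'a \<Rightarrow> real \<Rightarrow> 'b awalk measure" where
  "path_measure G len v T =
     uniform_measure (count_space (paths_from G v)) (paths_from_less G len v T)"

lemma measure_path_measure:
  assumes "finite (paths_from_less G len v T)" "paths_from_less G len v T \<noteq> {}"
    and "E \<subseteq> paths_from G v"
  shows "measure (path_measure G len v T) E =
    real (card (E \<inter> paths_from_less G len v T)) / real (card (paths_from_less G len v T))"
proof -
  have sub: "paths_from_less G len v T \<subseteq> paths_from G v"
    by (auto simp: paths_from_less_def)
  have em: "emeasure (count_space (paths_from G v)) (paths_from_less G len v T) =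
      of_nat (card (paths_from_less G len v T))"
    using assms(1) sub by (simp add: emeasure_count_space)
  show ?thesis
    unfolding path_measure_def using assms sub
    by (subst measure_uniform_measure)
      (auto simp: em measure_count_space Int_commute card_eq_0_iff le_infI1)
qed

end

theory Submission
  imports Defs
begin

text \<open>
  Cut a path from the root at its visits to the root: it is a sequence of first-return loops followed
  by a path that never returns. For \<open>p\<close> weighted by \<open>exp (- \<sigma> * len p)\<close>, the sum over all paths from the
  root is then \<open>g(\<sigma>) / (1 - f(\<sigma>))\<close>, with \<open>f\<close> the sum over first-return loops and \<open>g\<close> the sum over
  nonreturning paths. The main point is a gap: with \<open>h\<close> the abscissa of convergence of this
  sum, \<open>f\<close> and \<open>g\<close> still converge at some \<open>s < h\<close>. Hence \<open>f(h) = 1\<close>, so \<open>exp (- h * len)\<close> is a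
  probability on first-return loops for which the length, and therefore the cost, has exponential moments.
  With \<open>\<Lambda> = E[cost] / E[len]\<close>, Chernoff's method bounds the number of paths of length less than
  \<open>T\<close> whose cost differs from \<open>\<Lambda> * T\<close> by more than \<open>\<delta> * T\<close> by \<open>exp (a * T)\<close> with \<open>a < h\<close>, up to a constant.
  The total number of paths of length less than \<open>T\<close> beats \<open>exp (b * T)\<close> for every \<open>b < h\<close>, so the
  exceptional paths do not contribute to the mean.
\<close>

section \<open>Weighted sums over sets of lists\<close>

text \<open>The graph is infinite, so no transfer matrix with a Perron-Frobenius eigenvalue is at
  hand, and two things could fail: the first-return sum could stay below 1 at the abscissa of
  convergence \<open>h\<close>, or loops could lack exponential moments there. The gap excludes
  both. It cannot be read off at \<open>h\<close> itself, where the sum over all paths diverges, so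
  returns to the root are estimated through ratios of partition functions at
  \<open>\<sigma> > h\<close>, with constants that survive the limit. G2 supplies the comparison
  between vertices, G1 the smallness of long arcs, and G3 two distinct first-return loops, which
  make \<open>h\<close> positive. Only exponential rates of path counts are compared: a strict
  inequality between exponents takes the place of precise asymptotics. Sums take values in
  \<open>ennreal\<close>, so that recursions can be used before convergence is known, and the weight
  is an arbitrary edge function, so that lengths and tilted costs obey the same recursions.\<close>

definition path_sum :: "('b \<Rightarrow> real) \<Rightarrow> 'b list set \<Rightarrow> ennreal" where
  "path_sum y A = (\<integral>\<^sup>+p. ennreal (exp (sum_list (map y p))) \<partial>count_space A)"

text \<open>As the measure of a set under a density, the sum inherits monotonicity, additivity and
  continuity along increasing unions.\<close>

lemma path_sum_emeasure:
  "path_sum y A = emeasure (density (count_space UNIV) (\<lambda>p. ennreal (exp (sum_list (map y p))))) A"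
  unfolding path_sum_def
  by (subst emeasure_density) (auto simp: nn_integral_count_space_indicator[of A])

lemma path_sum_mono: "A \<subseteq> B \<Longrightarrow> path_sum y A \<le> path_sum y B"
  unfolding path_sum_emeasure by (rule emeasure_mono) auto

lemma path_sum_mono_weight:
  assumes "\<And>p. p \<in> A \<Longrightarrow> sum_list (map y p) \<le> sum_list (map z p)"
  shows "path_sum y A \<le> path_sum z A"
  unfolding path_sum_def by (rule nn_integral_mono) (use assms in \<open>auto intro!: ennreal_leI\<close>)

lemma path_sum_empty [simp]: "path_sum y {} = 0"
  unfolding path_sum_emeasure by simp

lemma path_sum_singleton [simp]: "path_sum y {p} = ennreal (exp (sum_list (map y p)))"
  unfolding path_sum_def by (subst nn_integral_count_space_finite) auto

lemma path_sum_Un_le: "path_sum y (A \<union> B) \<le> path_sum y A + path_sum y B"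
  unfolding path_sum_emeasure by (rule emeasure_subadditive) auto

lemma path_sum_Un: "A \<inter> B = {} \<Longrightarrow> path_sum y (A \<union> B) = path_sum y A + path_sum y B"
  unfolding path_sum_emeasure by (rule plus_emeasure[symmetric]) auto

lemma path_sum_UN_le: "path_sum y (\<Union>n\<in>{..<N::nat}. A n) \<le> (\<Sum>n<N. path_sum y (A n))"
  unfolding path_sum_emeasure by (rule emeasure_subadditive_finite) auto

text \<open>Infinite families of paths are exhausted by those with boundedly many arcs, where
  induction applies; continuity from below carries a bound uniform in \<open>n\<close> to the whole
  family.\<close>

lemma path_sum_UN_bound:
  assumes "incseq A" and "\<And>n. path_sum y (A n) \<le> B"
  shows "path_sum y (\<Union>n. A n) \<le> B"
proof -
  have "path_sum y (\<Union>n. A n) = (SUP n. path_sum y (A n))"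
    unfolding path_sum_emeasure by (rule SUP_emeasure_incseq[symmetric]) (use assms in auto)
  with assms(2) show ?thesis by (simp add: SUP_least)
qed

lemma path_sum_image:
  assumes "inj_on f X"
  shows "path_sum y (f ` X) = (\<integral>\<^sup>+x. ennreal (exp (sum_list (map y (f x)))) \<partial>count_space X)"
  unfolding path_sum_def
  by (rule nn_integral_bij_count_space[symmetric]) (use assms in \<open>auto simp: bij_betw_def\<close>)

lemma path_sum_append_image: "path_sum y ((@) p ` A) = ennreal (exp (sum_list (map y p))) * path_sum y A"
proof -
  have "path_sum y ((@) p ` A) = (\<integral>\<^sup>+q. ennreal (exp (sum_list (map y p))) * ennreal (exp (sum_list (map y q))) \<partial>count_space A)"
    by (subst path_sum_image) (auto simp: inj_on_def exp_add ennreal_mult)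
  then show ?thesis
    by (simp add: nn_integral_cmult path_sum_def)
qed

text \<open>Tonelli for fibres that depend on the base point. Indicators extend both sums to the
  full types, where Tonelli for counting measures applies without countability.\<close>

lemma nn_integral_count_space_Sigma:
  fixes f :: "'x \<Rightarrow> 'y \<Rightarrow> ennreal"
  shows "(\<integral>\<^sup>+x. \<integral>\<^sup>+y. f x y \<partial>count_space (B x) \<partial>count_space A) =
    (\<integral>\<^sup>+z. f (fst z) (snd z) \<partial>count_space (SIGMA x:A. B x))"
proof -
  have "(\<integral>\<^sup>+x. \<integral>\<^sup>+y. f x y \<partial>count_space (B x) \<partial>count_space A) =
    (\<integral>\<^sup>+x. \<integral>\<^sup>+y. (\<lambda>z. f (fst z) (snd z) * indicator (SIGMA x:A. B x) z) (x, y) \<partial>count_space UNIV \<partial>count_space UNIV)"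
  proof -
    have "(\<integral>\<^sup>+y. f x y \<partial>count_space (B x)) * indicator A x =
        (\<integral>\<^sup>+y. f x y * indicator (SIGMA x:A. B x) (x, y) \<partial>count_space UNIV)" for x
      by (cases "x \<in> A") (auto simp: nn_integral_count_space_indicator[of "B x"] indicator_def intro!: nn_integral_cong)
    then show ?thesis
      by (simp add: nn_integral_count_space_indicator[of A])
  qed
  also have "\<dots> = (\<integral>\<^sup>+z. f (fst z) (snd z) * indicator (SIGMA x:A. B x) z \<partial>count_space UNIV)"
    by (rule nn_integral_fst_count_space)
  also have "\<dots> = (\<integral>\<^sup>+z. f (fst z) (snd z) \<partial>count_space (SIGMA x:A. B x))"
    by (simp add: nn_integral_count_space_indicator[of "Sigma A B"])
  finally show ?thesis .
qed

text \<open>Splitting off the first arc is the recursion behind most inductions on the number of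
  arcs. \<open>B\<close> depends on \<open>e\<close> because the rest of a path starts at the head
  of \<open>e\<close>.\<close>

lemma path_sum_Cons_UN:
  "path_sum y (\<Union>e\<in>A. (#) e ` B e) = (\<integral>\<^sup>+e. ennreal (exp (y e)) * path_sum y (B e) \<partial>count_space A)"
proof -
  have "(\<Union>e\<in>A. (#) e ` B e) = (\<lambda>z. fst z # snd z) ` (SIGMA e:A. B e)"
    by force
  then have "path_sum y (\<Union>e\<in>A. (#) e ` B e) =
      (\<integral>\<^sup>+z. ennreal (exp (sum_list (map y (fst z # snd z)))) \<partial>count_space (SIGMA e:A. B e))"
    by (subst path_sum_image[symmetric]) (auto simp: inj_on_def)
  also have "\<dots> = (\<integral>\<^sup>+e. \<integral>\<^sup>+p. ennreal (exp (sum_list (map y (e # p)))) \<partial>count_space (B e) \<partial>count_space A)"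
    by (subst nn_integral_count_space_Sigma) simp
  finally show ?thesis
    by (simp add: exp_add ennreal_mult nn_integral_cmult path_sum_def)
qed

lemma path_sum_append:
  assumes "inj_on (\<lambda>(p, q). p @ q) (A \<times> B)"
  shows "path_sum y ((\<lambda>(p, q). p @ q) ` (A \<times> B)) = path_sum y A * path_sum y B"
proof -
  have "path_sum y ((\<lambda>(p, q). p @ q) ` (A \<times> B)) =
      (\<integral>\<^sup>+z. ennreal (exp (sum_list (map y (fst z @ snd z)))) \<partial>count_space (A \<times> B))"
    by (subst path_sum_image[OF assms]) (auto intro!: nn_integral_cong simp: case_prod_beta)
  also have "\<dots> = (\<integral>\<^sup>+p. \<integral>\<^sup>+q. ennreal (exp (sum_list (map y (p @ q)))) \<partial>count_space B \<partial>count_space A)"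
    by (subst nn_integral_count_space_Sigma) simp
  finally show ?thesis
    by (simp add: exp_add ennreal_mult nn_integral_cmult nn_integral_multc path_sum_def)
qed

text \<open>Divergence is harmless in \<open>ennreal\<close>, while derivatives need real sums; this
  pair translates between the two.\<close>

lemma
  fixes f :: "'a \<Rightarrow> real"
  assumes "\<And>x. x \<in> A \<Longrightarrow> 0 \<le> f x"
  shows nn_integral_count_space_finite_iff: "(\<integral>\<^sup>+x. ennreal (f x) \<partial>count_space A) < \<infinity> \<longleftrightarrow> f summable_on A" (is ?t1)
    and nn_integral_count_space_infsum:
      "f summable_on A \<Longrightarrow> (\<integral>\<^sup>+x. ennreal (f x) \<partial>count_space A) = ennreal (\<Sum>\<^sub>\<infinity>x\<in>A. f x)"
proof -
  have "(\<integral>\<^sup>+x. ennreal \<bar>f x\<bar> \<partial>count_space A) = (\<integral>\<^sup>+x. ennreal (f x) \<partial>count_space A)"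
    by (rule nn_integral_cong) (use assms in auto)
  then have "(\<integral>\<^sup>+x. ennreal (f x) \<partial>count_space A) < \<infinity> \<longleftrightarrow> integrable (count_space A) f"
    unfolding integrable_iff_bounded by simp
  also have int: "\<dots> \<longleftrightarrow> f summable_on A"
    by (metis abs_summable_equivalent abs_summable_on_def summable_on_iff_abs_summable_on_real)
  finally show ?t1 .
  assume "f summable_on A"
  then have i: "integrable (count_space A) f"
    by (simp add: int)
  have "(\<integral>\<^sup>+x. ennreal (f x) \<partial>count_space A) = ennreal (\<integral>x. f x \<partial>count_space A)"
    by (rule nn_integral_eq_integral[OF i]) (use assms in \<open>auto simp: AE_count_space\<close>)
  also have "(\<integral>x. f x \<partial>count_space A) = (\<Sum>\<^sub>\<infinity>x\<in>A. f x)"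
    unfolding infsetsum_def[symmetric]
    by (rule infsetsum_infsum) (use i in \<open>simp add: abs_summable_on_def\<close>)
  finally show "(\<integral>\<^sup>+x. ennreal (f x) \<partial>count_space A) = ennreal (\<Sum>\<^sub>\<infinity>x\<in>A. f x)" .
qed

lemma path_sum_finite_iff:
  "path_sum y A < \<infinity> \<longleftrightarrow> (\<lambda>p. exp (sum_list (map y p))) summable_on A"
  unfolding path_sum_def by (rule nn_integral_count_space_finite_iff) simp

lemma path_sum_eq_infsum:
  "path_sum y A < \<infinity> \<Longrightarrow> path_sum y A = ennreal (\<Sum>\<^sub>\<infinity>p\<in>A. exp (sum_list (map y p)))"
  unfolding path_sum_finite_iff by (subst path_sum_def, rule nn_integral_count_space_infsum) auto

text \<open>Markov's inequality for the counting measure. With a weight that is large on exceptional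
  paths it becomes the Chernoff bound on their number.\<close>

lemma path_sum_card_bound:
  assumes "path_sum y A \<le> ennreal K" and "0 \<le> K" and "\<And>p. p \<in> A \<Longrightarrow> r \<le> sum_list (map y p)"
  shows "finite A" and "real (card A) \<le> K * exp (- r)"
proof -
  have le: "ennreal (exp r) * emeasure (count_space A) A \<le> ennreal K"
  proof -
    have "ennreal (exp r) * emeasure (count_space A) A = (\<integral>\<^sup>+p. ennreal (exp r) \<partial>count_space A)"
      by simp
    also have "\<dots> \<le> path_sum y A"
      unfolding path_sum_def by (rule nn_integral_mono) (use assms(3) in \<open>auto intro!: ennreal_leI\<close>)
    finally show ?thesis using assms(1) by simp
  qed
  show f: "finite A"
  proof (rule ccontr)
    assume "infinite A"
    then have "ennreal (exp r) * emeasure (count_space A) A = \<infinity>"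
      by (simp add: ennreal_mult_top)
    with le show False by (simp add: top_unique)
  qed
  have "ennreal (exp r * real (card A)) \<le> ennreal K"
    using le f by (simp add: ennreal_mult ennreal_of_nat_eq_real_of_nat)
  then have "exp r * real (card A) \<le> K"
    using assms(2) by simp
  then show "real (card A) \<le> K * exp (- r)"
    by (simp add: exp_minus field_simps)
qed

section \<open>Exponential moments\<close>

lemma exp_linear_remainder: "\<bar>exp z - 1 - z\<bar> \<le> z\<^sup>2 * exp \<bar>z\<bar>" for z :: real
proof -
  obtain t where t: "\<bar>t\<bar> \<le> \<bar>z\<bar>" "exp z = (\<Sum>m<2. z ^ m / fact m) + exp t / fact 2 * z ^ 2"
    using Maclaurin_exp_le by blast
  have "(\<Sum>m<2. z ^ m / fact m) = 1 + z"
    by (simp add: numeral_2_eq_2)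
  with t(2) have "\<bar>exp z - 1 - z\<bar> = exp t / 2 * z\<^sup>2"
    by simp
  also have "\<dots> \<le> exp \<bar>z\<bar> * z\<^sup>2"
  proof (rule mult_right_mono)
    have "exp t \<le> exp \<bar>z\<bar>"
      using t(1) by simp
    then show "exp t / 2 \<le> exp \<bar>z\<bar>"
      using exp_gt_zero[of t] by linarith
  qed simp
  finally show ?thesis by (simp add: mult.commute)
qed

text \<open>Half of the exponent \<open>\<epsilon>\<close> dominates \<open>exp (t * y x)\<close>;
  the other half absorbs the quadratic factor of the Taylor remainder.\<close>

lemma exp_moment_expansion:
  fixes w y l :: "'a \<Rightarrow> real"
  assumes w: "\<And>x. x \<in> X \<Longrightarrow> 0 \<le> w x" and y: "\<And>x. x \<in> X \<Longrightarrow> \<bar>y x\<bar> \<le> l x" and \<epsilon>: "0 < \<epsilon>"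
    and sm: "(\<lambda>x. w x * exp (\<epsilon> * l x)) summable_on X"
  shows "(\<lambda>x. w x * y x) summable_on X"
    and "\<exists>K\<ge>0. \<forall>t. \<bar>t\<bar> \<le> \<epsilon> / 2 \<longrightarrow> (\<lambda>x. w x * exp (t * y x)) summable_on X \<and>
      \<bar>(\<Sum>\<^sub>\<infinity>x\<in>X. w x * exp (t * y x)) - ((\<Sum>\<^sub>\<infinity>x\<in>X. w x) + t * (\<Sum>\<^sub>\<infinity>x\<in>X. w x * y x))\<bar> \<le> K * t\<^sup>2"
proof -
  have l: "0 \<le> l x" if "x \<in> X" for x
    using y[OF that] by linarith
  have dom: "f summable_on X" if "\<And>x. x \<in> X \<Longrightarrow> \<bar>f x\<bar> \<le> c * (w x * exp (\<epsilon> * l x))" for f c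
  proof -
    have "(\<lambda>x. \<bar>f x\<bar>) summable_on X"
      by (rule summable_on_comparison_test[OF summable_on_cmult_right[OF sm]]) (use that in auto)
    then show ?thesis
      by (subst summable_on_iff_abs_summable_on_real) simp
  qed
  have s1: "w summable_on X"
    by (rule dom[of _ 1]) (use w l \<epsilon> in \<open>fastforce simp: mult_le_cancel_left1\<close>)
  show s2: "(\<lambda>x. w x * y x) summable_on X"
  proof (rule dom[of _ "1 / \<epsilon>"])
    fix x assume x: "x \<in> X"
    have "\<epsilon> * l x \<le> exp (\<epsilon> * l x)"
      using exp_ge_add_one_self[of "\<epsilon> * l x"] by linarith
    then have "l x \<le> exp (\<epsilon> * l x) / \<epsilon>"
      using \<epsilon> by (simp add: field_simps)
    with y[OF x] have "\<bar>y x\<bar> \<le> exp (\<epsilon> * l x) / \<epsilon>"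
      by linarith
    then have "w x * \<bar>y x\<bar> \<le> w x * (exp (\<epsilon> * l x) / \<epsilon>)"
      using w[OF x] by (rule mult_left_mono)
    then show "\<bar>w x * y x\<bar> \<le> 1 / \<epsilon> * (w x * exp (\<epsilon> * l x))"
      using w[OF x] by (simp add: abs_mult)
  qed
  have ty: "\<bar>t * y x\<bar> \<le> \<epsilon> / 2 * l x" if "x \<in> X" "\<bar>t\<bar> \<le> \<epsilon> / 2" for x t
    unfolding abs_mult using that y[OF that(1)] by (intro mult_mono) auto
  have s3: "(\<lambda>x. w x * exp (t * y x)) summable_on X" if t: "\<bar>t\<bar> \<le> \<epsilon> / 2" for t
  proof (rule dom[of _ 1])
    fix x assume x: "x \<in> X"
    have "t * y x \<le> \<epsilon> * l x"
      using ty[OF x t] mult_nonneg_nonneg[of \<epsilon> "l x"] \<epsilon> l[OF x] by linarith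
    then show "\<bar>w x * exp (t * y x)\<bar> \<le> 1 * (w x * exp (\<epsilon> * l x))"
      using w[OF x] by (auto simp: abs_mult intro!: mult_left_mono)
  qed
  \<comment> \<open>The factor 8 comes from \<open>z\<^sup>2 / 2 \<le> exp z\<close> at
    \<open>z = \<epsilon> / 2 * l x\<close>.\<close>
  define K where "K = 8 / \<epsilon>\<^sup>2 * (\<Sum>\<^sub>\<infinity>x\<in>X. w x * exp (\<epsilon> * l x))"
  have bound: "\<bar>w x * exp (t * y x) - (w x + t * (w x * y x))\<bar> \<le> 8 / \<epsilon>\<^sup>2 * t\<^sup>2 * (w x * exp (\<epsilon> * l x))"
    if t: "\<bar>t\<bar> \<le> \<epsilon> / 2" and x: "x \<in> X" for t x
  proof -
    have sq: "(l x)\<^sup>2 \<le> 8 / \<epsilon>\<^sup>2 * exp (\<epsilon> / 2 * l x)"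
    proof -
      have "(\<epsilon> / 2 * l x)\<^sup>2 / 2 \<le> exp (\<epsilon> / 2 * l x)"
        using exp_lower_Taylor_quadratic[of "\<epsilon> / 2 * l x"] \<epsilon> l[OF x] mult_nonneg_nonneg[of "\<epsilon> / 2" "l x"] by linarith
      then show ?thesis
        using \<epsilon> by (simp add: field_simps power2_eq_square)
    qed
    have "\<bar>exp (t * y x) - 1 - t * y x\<bar> \<le> (t * y x)\<^sup>2 * exp \<bar>t * y x\<bar>"
      by (rule exp_linear_remainder)
    also have "\<dots> \<le> (t\<^sup>2 * (l x)\<^sup>2) * exp (\<epsilon> / 2 * l x)"
      using ty[OF x t] y[OF x] l[OF x]
      by (intro mult_mono) (auto simp: power_mult_distrib abs_le_square_iff[symmetric] intro!: mult_left_mono)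
    also have "\<dots> \<le> (t\<^sup>2 * (8 / \<epsilon>\<^sup>2 * exp (\<epsilon> / 2 * l x))) * exp (\<epsilon> / 2 * l x)"
      using sq by (intro mult_right_mono mult_left_mono) auto
    also have "\<dots> = 8 / \<epsilon>\<^sup>2 * t\<^sup>2 * exp (\<epsilon> * l x)"
      by (simp add: mult_exp_exp field_simps)
    finally have "w x * \<bar>exp (t * y x) - 1 - t * y x\<bar> \<le> w x * (8 / \<epsilon>\<^sup>2 * t\<^sup>2 * exp (\<epsilon> * l x))"
      using w[OF x] by (rule mult_left_mono)
    moreover have "w x * exp (t * y x) - (w x + t * (w x * y x)) = w x * (exp (t * y x) - 1 - t * y x)"
      by (simp add: algebra_simps)
    ultimately show ?thesis
      using w[OF x] by (simp add: abs_mult mult_ac)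
  qed
  have "\<bar>(\<Sum>\<^sub>\<infinity>x\<in>X. w x * exp (t * y x)) - ((\<Sum>\<^sub>\<infinity>x\<in>X. w x) + t * (\<Sum>\<^sub>\<infinity>x\<in>X. w x * y x))\<bar> \<le> K * t\<^sup>2"
    if t: "\<bar>t\<bar> \<le> \<epsilon> / 2" for t
  proof -
    let ?d = "\<lambda>x. w x * exp (t * y x) - (w x + t * (w x * y x))"
    have s4: "(\<lambda>x. w x + t * (w x * y x)) summable_on X"
      by (intro summable_on_add summable_on_cmult_right s1 s2)
    have sd: "?d summable_on X"
      by (rule dom[OF bound[OF t]])
    have "(\<Sum>\<^sub>\<infinity>x\<in>X. w x * exp (t * y x)) = (\<Sum>\<^sub>\<infinity>x\<in>X. (w x + t * (w x * y x)) + ?d x)"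
      by simp
    also have "\<dots> = (\<Sum>\<^sub>\<infinity>x\<in>X. w x + t * (w x * y x)) + infsum ?d X"
      by (rule infsum_add[OF s4 sd])
    also have "(\<Sum>\<^sub>\<infinity>x\<in>X. w x + t * (w x * y x)) = (\<Sum>\<^sub>\<infinity>x\<in>X. w x) + t * (\<Sum>\<^sub>\<infinity>x\<in>X. w x * y x)"
      using s1 s2 by (simp add: infsum_add infsum_cmult_right summable_on_cmult_right)
    finally have "(\<Sum>\<^sub>\<infinity>x\<in>X. w x * exp (t * y x)) - ((\<Sum>\<^sub>\<infinity>x\<in>X. w x) + t * (\<Sum>\<^sub>\<infinity>x\<in>X. w x * y x)) = infsum ?d X"
      by simp
    moreover have "\<bar>infsum ?d X\<bar> \<le> 8 / \<epsilon>\<^sup>2 * t\<^sup>2 * (\<Sum>\<^sub>\<infinity>x\<in>X. w x * exp (\<epsilon> * l x))"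
    proof -
      have sn: "(\<lambda>x. \<bar>?d x\<bar>) summable_on X"
        using sd by (subst (asm) summable_on_iff_abs_summable_on_real) simp
      have "\<bar>infsum ?d X\<bar> \<le> (\<Sum>\<^sub>\<infinity>x\<in>X. \<bar>?d x\<bar>)"
        using norm_infsum_bound[of ?d X] sn by simp
      also have "\<dots> \<le> (\<Sum>\<^sub>\<infinity>x\<in>X. 8 / \<epsilon>\<^sup>2 * t\<^sup>2 * (w x * exp (\<epsilon> * l x)))"
        by (rule infsum_mono[OF sn summable_on_cmult_right[OF sm] bound[OF t]])
      also have "\<dots> = 8 / \<epsilon>\<^sup>2 * t\<^sup>2 * (\<Sum>\<^sub>\<infinity>x\<in>X. w x * exp (\<epsilon> * l x))"
        by (rule infsum_cmult_right) (use sm in simp)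
      finally show ?thesis .
    qed
    ultimately show ?thesis
      unfolding K_def by (simp add: mult_ac)
  qed
  moreover have "0 \<le> K"
    unfolding K_def by (intro mult_nonneg_nonneg infsum_nonneg) (use w in auto)
  ultimately show "\<exists>K\<ge>0. \<forall>t. \<bar>t\<bar> \<le> \<epsilon> / 2 \<longrightarrow> (\<lambda>x. w x * exp (t * y x)) summable_on X \<and>
      \<bar>(\<Sum>\<^sub>\<infinity>x\<in>X. w x * exp (t * y x)) - ((\<Sum>\<^sub>\<infinity>x\<in>X. w x) + t * (\<Sum>\<^sub>\<infinity>x\<in>X. w x * y x))\<bar> \<le> K * t\<^sup>2"
    using s3 by blast
qed

text \<open>The derivative at 0 serves two purposes: for \<open>y\<close> the negative length it
  gives continuity of a partition function in its exponent, and for \<open>y\<close> a cost of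
  negative mean it makes a small tilt subcritical.\<close>

lemma
  fixes w y l :: "'a \<Rightarrow> real"
  assumes "\<And>x. x \<in> X \<Longrightarrow> 0 \<le> w x" "\<And>x. x \<in> X \<Longrightarrow> \<bar>y x\<bar> \<le> l x" and \<epsilon>: "0 < \<epsilon>"
    and "(\<lambda>x. w x * exp (\<epsilon> * l x)) summable_on X"
  shows exp_moment_summable: "\<bar>t\<bar> \<le> \<epsilon> / 2 \<Longrightarrow> (\<lambda>x. w x * exp (t * y x)) summable_on X"
    and exp_moment_deriv:
      "((\<lambda>t. \<Sum>\<^sub>\<infinity>x\<in>X. w x * exp (t * y x)) has_real_derivative (\<Sum>\<^sub>\<infinity>x\<in>X. w x * y x)) (at 0)"
proof -
  obtain K where K: "K \<ge> 0" "\<And>t. \<bar>t\<bar> \<le> \<epsilon> / 2 \<Longrightarrow> (\<lambda>x. w x * exp (t * y x)) summable_on X"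
    "\<And>t. \<bar>t\<bar> \<le> \<epsilon> / 2 \<Longrightarrow> \<bar>(\<Sum>\<^sub>\<infinity>x\<in>X. w x * exp (t * y x)) - ((\<Sum>\<^sub>\<infinity>x\<in>X. w x) + t * (\<Sum>\<^sub>\<infinity>x\<in>X. w x * y x))\<bar> \<le> K * t\<^sup>2"
    using exp_moment_expansion(2)[of X w y l \<epsilon>] assms by blast
  show "\<bar>t\<bar> \<le> \<epsilon> / 2 \<Longrightarrow> (\<lambda>x. w x * exp (t * y x)) summable_on X"
    by (rule K(2))
  let ?f = "\<lambda>t. \<Sum>\<^sub>\<infinity>x\<in>X. w x * exp (t * y x)" and ?c = "\<Sum>\<^sub>\<infinity>x\<in>X. w x * y x"
  have ev: "eventually (\<lambda>t. \<bar>t\<bar> \<le> \<epsilon> / 2 \<and> t \<noteq> 0) (at (0::real))"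
    using \<epsilon> by (auto simp: eventually_at intro!: exI[of _ "\<epsilon> / 2"])
  have "((\<lambda>t. (?f t - ?f 0) / t - ?c) \<longlongrightarrow> 0) (at 0)"
  proof (rule Lim_null_comparison)
    show "eventually (\<lambda>t. norm ((?f t - ?f 0) / t - ?c) \<le> K * \<bar>t\<bar>) (at 0)"
      using ev
    proof eventually_elim
      case (elim t)
      have "norm ((?f t - ?f 0) / t - ?c) = \<bar>?f t - (infsum w X + t * ?c)\<bar> / \<bar>t\<bar>"
        using elim by (simp add: field_simps flip: abs_divide)
      also have "\<dots> \<le> K * t\<^sup>2 / \<bar>t\<bar>"
        using K(3) elim by (intro divide_right_mono) auto
      also have "\<dots> = K * \<bar>t\<bar>"
        using elim by (simp add: power2_eq_square field_simps abs_if)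
      finally show ?case .
    qed
    show "((\<lambda>t. K * \<bar>t\<bar>) \<longlongrightarrow> 0) (at 0)"
      by (auto intro!: tendsto_eq_intros)
  qed
  then show "(?f has_real_derivative ?c) (at 0)"
    unfolding has_field_derivative_iff by (simp add: LIM_zero_iff)
qed

lemma infsum_pos:
  fixes f :: "'a \<Rightarrow> real"
  assumes "f summable_on A" "\<And>x. x \<in> A \<Longrightarrow> 0 \<le> f x" "a \<in> A" "0 < f a"
  shows "0 < infsum f A"
proof -
  have "sum f {a} \<le> infsum f A"
    by (rule finite_sum_le_infsum) (use assms in auto)
  with assms(4) show ?thesis by simp
qed

section \<open>Connectivity\<close>

locale rooted_length_digraph = length_digraph G len
  for G :: "('a, 'b) pre_digraph" and len :: "'b \<Rightarrow> real" +
  fixes v :: 'a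
  assumes root: "v \<in> verts G" and G1: "G1 G len" and G2: "G2 G len" and G3: "G3 G len"
begin

abbreviation total_len :: "'b awalk \<Rightarrow> real" where
  "total_len p \<equiv> sum_list (map len p)"

lemma total_len_nonneg: "set p \<subseteq> arcs G \<Longrightarrow> 0 \<le> total_len p"
  by (intro sum_list_nonneg) (auto dest: len_pos intro: less_imp_le)

lemma total_len_pos: "set p \<subseteq> arcs G \<Longrightarrow> p \<noteq> [] \<Longrightarrow> 0 < total_len p"
  using total_len_nonneg by (cases p) (auto dest: len_pos intro: add_pos_nonneg)

lemma Nil_in_paths_from [simp]: "[] \<in> paths_from G x \<longleftrightarrow> x \<in> verts G"
  by (auto simp: paths_from_def awalk_Nil_iff)

lemma Cons_in_paths_from [simp]:
  "e # p \<in> paths_from G x \<longleftrightarrow> e \<in> out_arcs G x \<and> p \<in> paths_from G (head G e)"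
  by (auto simp: paths_from_def awalk_Cons_iff)

lemma append_in_paths_from: "awalk x p w \<Longrightarrow> p @ q \<in> paths_from G x \<longleftrightarrow> q \<in> paths_from G w"
  by (induction p arbitrary: x) (auto simp: awalk_Cons_iff awalk_Nil_iff)

lemma paths_from_arcs: "p \<in> paths_from G x \<Longrightarrow> set p \<subseteq> arcs G"
  by (auto simp: paths_from_def)

lemma awalk_ends:
  assumes "awalk x p w" "p \<noteq> []"
  shows "tail G (hd p) = x" "head G (last p) = w" "hd p \<in> arcs G" "last p \<in> arcs G"
  using assms by (induction p arbitrary: x) (auto simp: awalk_Cons_iff awalk_Nil_iff split: if_splits)

text \<open>Without nonempty closed walks the set of their lengths would be empty, hence contained
  in the multiples of 1, which G3 forbids.\<close>

lemma closed_walk_exists: "\<exists>x p. awalk x p x \<and> p \<noteq> []"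
proof (rule ccontr)
  assume "\<not> ?thesis"
  then have "{awalk_cost len p | p. closed_w p} \<subseteq> {1 * real n | n. True}"
    by (auto simp: closed_w_def)
  with G3 show False
    unfolding G3_def using zero_less_one by blast
qed

lemma middle_of_walk:
  assumes "awalk x p w" "p \<noteq> []" "hd p \<noteq> last p"
  shows "\<exists>q. awalk (head G (hd p)) q (tail G (last p)) \<and> p = hd p # q @ [last p]"
proof -
  obtain e p' where p: "p = e # p'"
    using assms(2) by (cases p) auto
  with assms have "p' \<noteq> []" by auto
  then obtain q f where "p' = q @ [f]"
    by (metis append_butlast_last_id)
  with p assms(1) show ?thesis
    by (auto simp: awalk_Cons_iff awalk_Nil_iff)
qed

text \<open>For \<open>e = f\<close>, G2 may be realised by the one-arc walk \<open>[e]\<close>,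
  which says nothing about returning. A detour through a second arc repairs this; if there is none,
  the existing closed walk forces \<open>e\<close> to be a loop.\<close>

lemma arc_to_arc:
  assumes "e \<in> arcs G" "f \<in> arcs G"
  shows "\<exists>q. awalk (head G e) q (tail G f)"
proof -
  have neq: "\<exists>q. awalk (head G e) q (tail G f)" if "e \<in> arcs G" "f \<in> arcs G" "e \<noteq> f" for e f
  proof -
    from G2 that obtain u p w where "awalk u p w" "p \<noteq> []" "hd p = e" "last p = f"
      unfolding G2_def by blast
    with middle_of_walk that(3) show ?thesis by blast
  qed
  show ?thesis
  proof (cases "\<exists>g\<in>arcs G. g \<noteq> e")
    case True
    then obtain g where g: "g \<in> arcs G" "g \<noteq> e" by blast
    show ?thesis
    proof (cases "e = f")
      case True
      obtain q r where "awalk (head G e) q (tail G g)" "awalk (head G g) r (tail G f)"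
        using neq g assms True by metis
      then have "awalk (head G e) (q @ g # r) (tail G f)"
        using g by (auto simp: awalk_Cons_iff)
      then show ?thesis ..
    qed (use neq assms in blast)
  next
    case False
    obtain x p where p: "awalk x p x" "p \<noteq> []"
      using closed_walk_exists by blast
    then have "tail G e = x \<and> head G e = x"
      using awalk_ends[OF p] False by metis
    moreover have "f = e" using False assms by blast
    ultimately show ?thesis
      using assms by (intro exI[of _ "[]"]) (auto simp: awalk_Nil_iff)
  qed
qed

text \<open>An arc at \<open>x\<close> lies on a closed walk, which both enters and leaves
  \<open>x\<close>; the empty connecting walk is the case of a loop.\<close>

lemma
  assumes "x \<in> verts G"
  shows in_arc: "\<exists>e\<in>arcs G. head G e = x" and out_arc: "\<exists>e\<in>arcs G. tail G e = x"
proof -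
  obtain e where e: "e \<in> arcs G" "tail G e = x \<or> head G e = x"
    using incident_arc assms by blast
  obtain q where q: "awalk (head G e) q (tail G e)"
    using arc_to_arc e by blast
  show "\<exists>e\<in>arcs G. head G e = x" "\<exists>e\<in>arcs G. tail G e = x"
    by (cases "q = []"; use q e awalk_ends[OF q] in \<open>auto simp: awalk_Nil_iff\<close>)+
qed

text \<open>Take the G2 walk from an arc into \<open>x\<close> to an arc out of the root. Removing
  its two end arcs removes exactly their lengths from the bound, so what remains does not depend on
  \<open>x\<close>. A closed walk at the root is appended to make the result nonempty.\<close>

lemma uniform_path_to_root: "\<exists>D>0. \<forall>x\<in>verts G. \<exists>q. awalk x q v \<and> q \<noteq> [] \<and> total_len q \<le> D"
proof -
  obtain e where e: "e \<in> arcs G" "tail G e = v"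
    using out_arc[OF root] by blast
  obtain r where r: "awalk (head G e) r v"
    using arc_to_arc[OF e(1) e(1)] e(2) by blast
  have er: "awalk v (e # r) v"
    using e r by (auto simp: awalk_Cons_iff)
  obtain C where C: "C > 0" "\<And>f g. f \<in> arcs G \<Longrightarrow> g \<in> arcs G \<Longrightarrow>
     \<exists>u p w. awalk u p w \<and> p \<noteq> [] \<and> hd p = f \<and> last p = g \<and> awalk_cost len p < C + len f + len g"
    using G2 unfolding G2_def by blast
  have r0: "0 \<le> total_len r" and er0: "0 \<le> total_len (e # r)"
    using total_len_nonneg r er by blast+
  have short: "\<exists>q. awalk x q v \<and> total_len q \<le> C + total_len r" if x: "x \<in> verts G" for x
  proof -
    obtain f where f: "f \<in> arcs G" "head G f = x"
      using in_arc[OF x] by blast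
    show ?thesis
    proof (cases "f = e")
      case True
      then show ?thesis using r f C(1) by force
    next
      case False
      obtain u p w where p: "awalk u p w" "p \<noteq> []" "hd p = f" "last p = e" "awalk_cost len p < C + len f + len e"
        using C(2)[OF f(1) e(1)] by blast
      obtain q where "awalk x q v" "p = f # q @ [e]"
        using middle_of_walk[OF p(1,2)] p(3,4) False e f by auto
      with p(5) r0 show ?thesis
        by (intro exI[of _ q]) (auto simp: awalk_cost_def)
    qed
  qed
  have "\<exists>q. awalk x q v \<and> q \<noteq> [] \<and> total_len q \<le> C + total_len r + total_len (e # r)"
    if x: "x \<in> verts G" for x
  proof -
    obtain q where "awalk x q v" "total_len q \<le> C + total_len r"
      using short[OF x] by blast
    then show ?thesis
      using er by (intro exI[of _ "q @ e # r"]) auto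
  qed
  moreover have "0 < C + total_len r + total_len (e # r)"
    using C(1) r0 er0 by linarith
  ultimately show ?thesis by blast
qed

text \<open>Here the final arc \<open>f\<close> is kept, so that up to a constant factor the weight
  of \<open>f\<close> is at most that of a path from the root to its head.\<close>

lemma uniform_path_from_root: "\<exists>C>0. \<forall>f\<in>arcs G. \<exists>q. awalk v q (head G f) \<and> total_len q \<le> C + len f"
proof -
  obtain e where e: "e \<in> arcs G" "tail G e = v"
    using out_arc[OF root] by blast
  obtain C where C: "C > 0" "\<And>f g. f \<in> arcs G \<Longrightarrow> g \<in> arcs G \<Longrightarrow>
     \<exists>u p w. awalk u p w \<and> p \<noteq> [] \<and> hd p = f \<and> last p = g \<and> awalk_cost len p < C + len f + len g"
    using G2 unfolding G2_def by blast
  have "\<exists>q. awalk v q (head G f) \<and> total_len q \<le> (C + len e) + len f" if f: "f \<in> arcs G" for f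
  proof -
    obtain u p w where p: "awalk u p w" "p \<noteq> []" "hd p = e" "last p = f" "awalk_cost len p < C + len e + len f"
      using C(2)[OF e(1) f] by blast
    with awalk_ends[OF p(1,2)] e show ?thesis
      by (intro exI[of _ p]) (auto simp: awalk_cost_def)
  qed
  then show ?thesis
    using C(1) len_pos[OF e(1)] by (intro exI[of _ "C + len e"]) auto
qed

lemma strongly_connected_walks:
  assumes "x \<in> verts G" "w \<in> verts G"
  shows "\<exists>p. awalk x p w"
proof -
  obtain f where "f \<in> arcs G" "head G f = w"
    using in_arc[OF assms(2)] by blast
  then show ?thesis
    using uniform_path_to_root uniform_path_from_root assms(1) by (meson awalk_appendI)
qed

section \<open>Partition functions\<close>

abbreviation len_sum :: "real \<Rightarrow> 'b awalk set \<Rightarrow> ennreal" where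
  "len_sum \<sigma> A \<equiv> path_sum (\<lambda>e. - (\<sigma> * len e)) A"

abbreviation partition_fun :: "real \<Rightarrow> 'a \<Rightarrow> ennreal" where
  "partition_fun \<sigma> x \<equiv> len_sum \<sigma> (paths_from G x)"

lemma sum_list_len [simp]: "sum_list (map (\<lambda>e. - (\<sigma> * len e)) p) = - (\<sigma> * total_len p)"
  by (induction p) (simp_all add: algebra_simps)

lemma len_sum_antimono:
  assumes "\<sigma> \<le> \<tau>" "\<And>p. p \<in> A \<Longrightarrow> set p \<subseteq> arcs G"
  shows "len_sum \<tau> A \<le> len_sum \<sigma> A"
proof (rule path_sum_mono_weight)
  fix p assume "p \<in> A"
  then have "\<sigma> * total_len p \<le> \<tau> * total_len p"
    using assms total_len_nonneg by (intro mult_right_mono) auto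
  then show "sum_list (map (\<lambda>e. - (\<tau> * len e)) p) \<le> sum_list (map (\<lambda>e. - (\<sigma> * len e)) p)"
    by simp
qed

definition arc_sum :: "real \<Rightarrow> real" where
  "arc_sum \<sigma> = (\<Sum>\<^sub>\<infinity>e\<in>arcs G. exp (- (\<sigma> * len e)))"

lemma arc_sum_summable: "0 < \<sigma> \<Longrightarrow> (\<lambda>e. exp (- (\<sigma> * len e))) summable_on arcs G"
  using G1 unfolding G1_def by auto

lemma nn_integral_arc_sum:
  "0 < \<sigma> \<Longrightarrow> (\<integral>\<^sup>+e. ennreal (exp (- (\<sigma> * len e))) \<partial>count_space (arcs G)) = ennreal (arc_sum \<sigma>)"
  unfolding arc_sum_def by (rule nn_integral_count_space_infsum) (use arc_sum_summable in auto)

lemma arc_sum_nonneg: "0 \<le> arc_sum \<sigma>"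
  unfolding arc_sum_def by (rule infsum_nonneg) auto

text \<open>G1 at \<open>\<sigma> / 2\<close> leaves an exponential moment of order
  \<open>\<sigma> / 2\<close> to spare.\<close>

lemma isCont_arc_sum:
  assumes "0 < \<sigma>"
  shows "isCont arc_sum \<sigma>"
proof -
  have "exp (- (\<sigma> * len e)) * exp (\<sigma> / 2 * len e) = exp (- (\<sigma> / 2 * len e))" for e
    by (simp add: mult_exp_exp)
  then have "(\<lambda>e. exp (- (\<sigma> * len e)) * exp (\<sigma> / 2 * len e)) summable_on arcs G"
    using arc_sum_summable[of "\<sigma> / 2"] assms by simp
  then have "((\<lambda>t. \<Sum>\<^sub>\<infinity>e\<in>arcs G. exp (- (\<sigma> * len e)) * exp (t * - len e)) has_real_derivative
      (\<Sum>\<^sub>\<infinity>e\<in>arcs G. exp (- (\<sigma> * len e)) * - len e)) (at 0)"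
    by (rule exp_moment_deriv[rotated 3]) (use assms len_pos in \<open>auto intro: less_imp_le\<close>)
  moreover have "exp (- (\<sigma> * len e)) * exp (t * - len e) = exp (- ((\<sigma> + t) * len e))" for t e
    by (simp add: mult_exp_exp algebra_simps)
  ultimately have "isCont (\<lambda>t. arc_sum (\<sigma> + t)) 0"
    unfolding arc_sum_def by (simp only: DERIV_isCont)
  then show ?thesis
    by (simp add: isCont_iff)
qed

text \<open>Arcs of length at most 1 have weight at least \<open>exp (- 1)\<close> each, while G1
  bounds their total weight at exponent 1. There are thus finitely many, and the smallest length is
  positive.\<close>

lemma uniform_len_bound: "\<exists>m>0. \<forall>e\<in>arcs G. m \<le> len e"
proof -
  have "path_sum (\<lambda>e. - len e) (\<Union>e\<in>arcs G. (#) e ` {[]}) = ennreal (arc_sum 1)"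
    unfolding path_sum_Cons_UN using nn_integral_arc_sum[of 1] by simp
  then have "path_sum (\<lambda>e. - len e) ((\<lambda>e. [e]) ` {e \<in> arcs G. len e \<le> 1}) \<le> ennreal (arc_sum 1)"
    by (metis (no_types, lifting) path_sum_mono[of "(\<lambda>e. [e]) ` {e \<in> arcs G. len e \<le> 1}" "\<Union>e\<in>arcs G. (#) e ` {[]}"] UN_I image_eqI image_subsetI mem_Collect_eq singletonI)
  then have "finite ((\<lambda>e. [e]) ` {e \<in> arcs G. len e \<le> 1})"
    by (rule path_sum_card_bound(1)[where r = "-1"]) (auto simp: arc_sum_nonneg)
  then have fin: "finite {e \<in> arcs G. len e \<le> 1}"
    by (rule finite_imageD) (auto simp: inj_on_def)
  define m where "m = Min (insert 1 (len ` {e \<in> arcs G. len e \<le> 1}))"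
  have "0 < m"
    unfolding m_def using fin len_pos by (subst Min_gr_iff) auto
  moreover have "m \<le> len e" if "e \<in> arcs G" for e
  proof (cases "len e \<le> 1")
    case False
    have "m \<le> 1" unfolding m_def using fin by (intro Min_le) auto
    with False show ?thesis by simp
  qed (unfold m_def, use fin that in \<open>intro Min_le; auto\<close>)
  ultimately show ?thesis by blast
qed

lemma length_bound: "\<exists>k. \<forall>q. set q \<subseteq> arcs G \<longrightarrow> total_len q \<le> D \<longrightarrow> length q \<le> k"
proof -
  obtain m where m: "m > 0" "\<And>e. e \<in> arcs G \<Longrightarrow> m \<le> len e"
    using uniform_len_bound by blast
  have l: "m * real (length q) \<le> total_len q" if "set q \<subseteq> arcs G" for q
    using that by (induction q) (auto simp: algebra_simps dest: m(2) intro: add_mono)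
  have "length q \<le> nat \<lceil>D / m\<rceil>" if "set q \<subseteq> arcs G" "total_len q \<le> D" for q
  proof -
    have "real (length q) \<le> D / m"
      using l[OF that(1)] that(2) m(1) by (simp add: field_simps)
    then show ?thesis by linarith
  qed
  then show ?thesis by blast
qed

text \<open>Prepending \<open>q\<close> embeds the paths from \<open>w\<close> into those from
  \<open>x\<close>: a Harnack-type comparison between vertices.\<close>

lemma path_sum_prefix_le:
  assumes "awalk x q w"
  shows "ennreal (exp (sum_list (map y q))) * path_sum y (paths_from G w) \<le> path_sum y (paths_from G x)"
  unfolding path_sum_append_image[symmetric]
  by (rule path_sum_mono) (use append_in_paths_from[OF assms] in auto)

lemma partition_fun_ge_1:
  assumes "x \<in> verts G"
  shows "1 \<le> partition_fun \<sigma> x"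
proof -
  have "len_sum \<sigma> {[]} \<le> partition_fun \<sigma> x"
    by (rule path_sum_mono) (use assms in auto)
  then show ?thesis by simp
qed

text \<open>
  By G2 a single arc contributes at most a fixed multiple of \<open>partition_fun \<sigma> v\<close>, however long it is. By
  G1 all but finitely many arcs have total weight at most \<open>1 / 2\<close>, so a bound \<open>M\<close> for walks of at most
  \<open>n\<close> arcs gives the bound \<open>const + M / 2\<close> for \<open>n + 1\<close> arcs. The constant is uniform in \<open>\<sigma>\<close>, although
  \<open>partition_fun \<sigma> v\<close> itself blows up as \<open>\<sigma>\<close> decreases to the abscissa of convergence.
\<close>

lemma partition_fun_le_root:
  assumes "0 < h"
  shows "\<exists>K\<ge>1. \<forall>\<sigma>. h \<le> \<sigma> \<longrightarrow> \<sigma> \<le> h + 1 \<longrightarrow> (\<forall>x\<in>verts G. partition_fun \<sigma> x \<le> ennreal K * partition_fun \<sigma> v)"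
proof -
  obtain C where C: "C > 0" "\<And>f. f \<in> arcs G \<Longrightarrow> \<exists>q. awalk v q (head G f) \<and> total_len q \<le> C + len f"
    using uniform_path_from_root by blast
  have "((\<lambda>e. exp (- (h * len e))) has_sum arc_sum h) (arcs G)"
    unfolding arc_sum_def using arc_sum_summable[OF assms] by simp
  \<comment> \<open>Larger exponents only shrink the weight outside \<open>F\<close>, so one finite
    set serves every \<open>\<sigma> \<ge> h\<close>.\<close>
  then obtain F where F: "finite F" "F \<subseteq> arcs G" "dist (\<Sum>e\<in>F. exp (- (h * len e))) (arc_sum h) \<le> 1 / 2"
    using has_sum_finite_approximation[of _ _ _ "1 / 2"] by force
  have tail: "(\<integral>\<^sup>+e. ennreal (exp (- (h * len e))) \<partial>count_space (arcs G - F)) \<le> ennreal (1 / 2)"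
  proof -
    have s: "(\<lambda>e. exp (- (h * len e))) summable_on (arcs G - F)"
      by (rule summable_on_subset_banach[OF arc_sum_summable[OF assms]]) auto
    have "(\<integral>\<^sup>+e. ennreal (exp (- (h * len e))) \<partial>count_space (arcs G - F)) =
        ennreal (\<Sum>\<^sub>\<infinity>e\<in>arcs G - F. exp (- (h * len e)))"
      by (rule nn_integral_count_space_infsum) (use s in auto)
    also have "(\<Sum>\<^sub>\<infinity>e\<in>arcs G - F. exp (- (h * len e))) = arc_sum h - (\<Sum>e\<in>F. exp (- (h * len e)))"
      unfolding arc_sum_def
      by (subst infsum_Diff) (use F arc_sum_summable[OF assms] in auto)
    finally have eq: "(\<integral>\<^sup>+e. ennreal (exp (- (h * len e))) \<partial>count_space (arcs G - F)) =
        ennreal (arc_sum h - (\<Sum>e\<in>F. exp (- (h * len e))))" .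
    have "arc_sum h - (\<Sum>e\<in>F. exp (- (h * len e))) \<le> 1 / 2"
      using F(3) unfolding dist_real_def by arith
    then show ?thesis unfolding eq by (rule ennreal_leI)
  qed
  \<comment> \<open>Each arc of \<open>F\<close> is traded for a path from the root at a price of at
    most \<open>exp (\<sigma> * C)\<close>, and \<open>\<sigma> \<le> h + 1\<close>.\<close>
  define c where "c = real (card F) * exp ((h + 1) * C)"
  have "partition_fun \<sigma> x \<le> ennreal (2 * (1 + c)) * partition_fun \<sigma> v"
    if \<sigma>: "h \<le> \<sigma>" "\<sigma> \<le> h + 1" and x: "x \<in> verts G" for \<sigma> x
  proof -
    \<comment> \<open>\<open>2 * B\<close> is the fixed point of the recursion
      \<open>M = B + M / 2\<close>, where \<open>M / 2\<close> accounts for the arcs outside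
      \<open>F\<close>.\<close>
    define B where "B = 1 + ennreal c * partition_fun \<sigma> v"
    have arc: "ennreal (exp (- (\<sigma> * len e))) * partition_fun \<sigma> (head G e) \<le> ennreal (exp ((h + 1) * C)) * partition_fun \<sigma> v"
      if e: "e \<in> arcs G" for e
    proof -
      obtain q where q: "awalk v q (head G e)" "total_len q \<le> C + len e"
        using C(2)[OF e] by blast
      have "\<sigma> * total_len q \<le> \<sigma> * (C + len e)"
        using q(2) \<sigma> assms by (intro mult_left_mono) auto
      moreover have "\<sigma> * C \<le> (h + 1) * C"
        using \<sigma> C(1) by (intro mult_right_mono) auto
      ultimately have "- (\<sigma> * len e) \<le> (h + 1) * C + - (\<sigma> * total_len q)"
        by (simp add: algebra_simps)
      then have "exp (- (\<sigma> * len e)) \<le> exp ((h + 1) * C) * exp (- (\<sigma> * total_len q))"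
        by (simp add: mult_exp_exp)
      then have "ennreal (exp (- (\<sigma> * len e))) * partition_fun \<sigma> (head G e) \<le>
          ennreal (exp ((h + 1) * C)) * (ennreal (exp (- (\<sigma> * total_len q))) * partition_fun \<sigma> (head G e))"
        unfolding mult.assoc[symmetric] by (intro mult_right_mono) (auto simp: ennreal_mult[symmetric] intro!: ennreal_leI)
      also have "\<dots> \<le> ennreal (exp ((h + 1) * C)) * partition_fun \<sigma> v"
        using path_sum_prefix_le[OF q(1), of "\<lambda>e. - (\<sigma> * len e)"] by (intro mult_left_mono) auto
      finally show ?thesis .
    qed
    have step: "len_sum \<sigma> {p \<in> paths_from G x. length p \<le> n} \<le> 2 * B" if "x \<in> verts G" for n x
      using that
    proof (induction n arbitrary: x)
      case 0
      then have "{p \<in> paths_from G x. length p \<le> 0} = {[]}"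
        by auto
      moreover have "1 \<le> 2 * B"
        unfolding B_def by (simp add: distrib_left add_increasing2)
      ultimately show ?case by simp
    next
      case (Suc n)
      let ?A = "\<lambda>x. {p \<in> paths_from G x. length p \<le> n}"
      let ?f = "\<lambda>e. ennreal (exp (- (\<sigma> * len e))) * len_sum \<sigma> (?A (head G e))"
      have "{p \<in> paths_from G x. length p \<le> Suc n} \<subseteq> {[]} \<union> (\<Union>e\<in>arcs G. (#) e ` ?A (head G e))"
        by (rule subsetI, rename_tac p, case_tac p) auto
      then have "len_sum \<sigma> {p \<in> paths_from G x. length p \<le> Suc n} \<le>
          len_sum \<sigma> ({[]} \<union> (\<Union>e\<in>arcs G. (#) e ` ?A (head G e)))"
        by (rule path_sum_mono)
      also have "\<dots> \<le> len_sum \<sigma> {[]} + len_sum \<sigma> (\<Union>e\<in>arcs G. (#) e ` ?A (head G e))"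
        by (rule path_sum_Un_le)
      also have "\<dots> = 1 + (\<integral>\<^sup>+e. ?f e \<partial>count_space (arcs G))"
        unfolding path_sum_Cons_UN by simp
      also have "(\<integral>\<^sup>+e. ?f e \<partial>count_space (arcs G)) \<le>
          (\<integral>\<^sup>+e. ?f e \<partial>count_space F) + (\<integral>\<^sup>+e. ?f e \<partial>count_space (arcs G - F))"
      proof -
        have "(\<integral>\<^sup>+e. ?f e \<partial>count_space (arcs G)) = (\<integral>\<^sup>+e. ?f e * indicator F e + ?f e * indicator (arcs G - F) e \<partial>count_space UNIV)"
          by (subst nn_integral_count_space_indicator, simp, rule nn_integral_cong)
            (use F(2) in \<open>auto simp: indicator_def\<close>)
        also have "\<dots> = (\<integral>\<^sup>+e. ?f e \<partial>count_space F) + (\<integral>\<^sup>+e. ?f e \<partial>count_space (arcs G - F))"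
          by (subst nn_integral_add) (auto simp: nn_integral_count_space_indicator[of F] nn_integral_count_space_indicator[of "arcs G - F"])
        finally show ?thesis by simp
      qed
      also have "(\<integral>\<^sup>+e. ?f e \<partial>count_space F) \<le> (\<integral>\<^sup>+e. ennreal (exp ((h + 1) * C)) * partition_fun \<sigma> v \<partial>count_space F)"
      proof (rule nn_integral_mono)
        fix e assume "e \<in> space (count_space F)"
        then have e: "e \<in> arcs G" using F(2) by auto
        have "?f e \<le> ennreal (exp (- (\<sigma> * len e))) * partition_fun \<sigma> (head G e)"
          by (intro mult_left_mono path_sum_mono) auto
        with arc[OF e] show "?f e \<le> ennreal (exp ((h + 1) * C)) * partition_fun \<sigma> v"
          by (rule order_trans[rotated])
      qed
      also have "\<dots> = ennreal c * partition_fun \<sigma> v"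
        using F(1) unfolding c_def by (simp add: ennreal_mult ennreal_of_nat_eq_real_of_nat mult_ac)
      also have "(\<integral>\<^sup>+e. ?f e \<partial>count_space (arcs G - F)) \<le>
          (\<integral>\<^sup>+e. ennreal (exp (- (h * len e))) * (2 * B) \<partial>count_space (arcs G - F))"
        using Suc.IH \<sigma> len_pos by (intro nn_integral_mono mult_mono) (auto intro!: ennreal_leI mult_right_mono dest: less_imp_le)
      also have "\<dots> = (\<integral>\<^sup>+e. ennreal (exp (- (h * len e))) \<partial>count_space (arcs G - F)) * (2 * B)"
        by (rule nn_integral_multc) auto
      also have "\<dots> \<le> ennreal (1 / 2) * (2 * B)"
        by (intro mult_right_mono tail) auto
      also have "\<dots> = B"
      proof -
        have "ennreal (1 / 2) * 2 = 1"
          using ennreal_mult[of "1 / 2" 2] by simp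
        then show ?thesis by (simp add: mult.assoc[symmetric])
      qed
      finally have "len_sum \<sigma> {p \<in> paths_from G x. length p \<le> Suc n} \<le> 1 + (ennreal c * partition_fun \<sigma> v + B)"
        by (simp add: add_left_mono)
      also have "\<dots> = 2 * B"
        unfolding B_def by (simp add: mult_2 add.assoc)
      finally show ?case .
    qed
    have "partition_fun \<sigma> x = len_sum \<sigma> (\<Union>n. {p \<in> paths_from G x. length p \<le> n})"
      by (rule arg_cong[where f = "len_sum \<sigma>"]) auto
    also have "\<dots> \<le> 2 * B"
      by (rule path_sum_UN_bound) (use step[OF x] in \<open>auto simp: incseq_def\<close>)
    also have "\<dots> \<le> 2 * (partition_fun \<sigma> v + ennreal c * partition_fun \<sigma> v)"
      unfolding B_def using partition_fun_ge_1[OF root] by (intro mult_left_mono add_right_mono) auto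
    also have "\<dots> = ennreal (2 * (1 + c)) * partition_fun \<sigma> v"
    proof -
      have "ennreal (2 * (1 + c)) = 2 * (1 + ennreal c)"
        unfolding c_def by (simp add: ennreal_mult ennreal_plus)
      then show ?thesis by (simp add: algebra_simps)
    qed
    finally show ?thesis .
  qed
  moreover have "1 \<le> 2 * (1 + c)"
    unfolding c_def by simp
  ultimately show ?thesis by blast
qed

section \<open>The gap for paths avoiding the root\<close>

definition avoiding_arcs :: "'a \<Rightarrow> 'b set" where
  "avoiding_arcs x = {e \<in> out_arcs G x. head G e \<noteq> v}"

text \<open>Only heads of arcs are tested, so starting at the root does not count as a
  visit.\<close>

definition avoiding :: "'a \<Rightarrow> nat \<Rightarrow> 'b awalk set" where
  "avoiding x n = {p \<in> paths_from G x. v \<notin> head G ` set p \<and> length p = n}"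

text \<open>The part after the first \<open>n\<close> arcs is free, which keeps the sum comparable
  with \<open>partition_fun\<close> and lets a contraction be iterated window by window.\<close>

definition avoiding_first :: "'a \<Rightarrow> nat \<Rightarrow> 'b awalk set" where
  "avoiding_first x n = {p \<in> paths_from G x. n \<le> length p \<and> v \<notin> head G ` set (take n p)}"

lemma avoiding_arcs_verts: "e \<in> avoiding_arcs x \<Longrightarrow> head G e \<in> verts G"
  by (auto simp: avoiding_arcs_def)

lemma avoiding_0: "x \<in> verts G \<Longrightarrow> avoiding x 0 = {[]}"
  by (auto simp: avoiding_def)

lemma avoiding_Suc: "avoiding x (Suc n) = (\<Union>e\<in>avoiding_arcs x. (#) e ` avoiding (head G e) n)"
  by (rule set_eqI, rename_tac p, case_tac p) (auto simp: avoiding_def avoiding_arcs_def)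

lemma avoiding_first_0: "avoiding_first x 0 = paths_from G x"
  by (auto simp: avoiding_first_def)

lemma avoiding_first_Suc:
  "avoiding_first x (Suc n) = (\<Union>e\<in>avoiding_arcs x. (#) e ` avoiding_first (head G e) n)"
  by (rule set_eqI, rename_tac p, case_tac p) (auto simp: avoiding_first_def avoiding_arcs_def)

text \<open>Paths that begin with \<open>q\<close> visit the root within their first
  \<open>k\<close> arcs, so they are disjoint from \<open>avoiding_first x k\<close>, and both
  families consist of paths from \<open>x\<close>.\<close>

lemma avoiding_first_detour:
  assumes q: "awalk x q v" "q \<noteq> []" "length q \<le> k"
  shows "len_sum \<sigma> (avoiding_first x k) + ennreal (exp (- (\<sigma> * total_len q))) * partition_fun \<sigma> v \<le> partition_fun \<sigma> x"
proof -
  have "v \<in> head G ` set (take k (q @ r))" for r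
    using awalk_ends(2)[OF q(1,2)] last_in_set[OF q(2)] q(3) by (auto simp: image_iff intro!: bexI[of _ "last q"])
  then have "avoiding_first x k \<inter> (@) q ` paths_from G v = {}"
    by (auto simp: avoiding_first_def)
  then have "len_sum \<sigma> (avoiding_first x k) + ennreal (exp (- (\<sigma> * total_len q))) * partition_fun \<sigma> v =
      len_sum \<sigma> (avoiding_first x k \<union> (@) q ` paths_from G v)"
    by (simp add: path_sum_Un path_sum_append_image)
  also have "\<dots> \<le> partition_fun \<sigma> x"
    by (rule path_sum_mono) (use append_in_paths_from[OF q(1)] in \<open>auto simp: avoiding_first_def\<close>)
  finally show ?thesis .
qed

text \<open>The Markov property: after \<open>n\<close> avoiding arcs the contraction applies afresh
  at the vertex reached, whichever it is.\<close>

lemma avoiding_first_add: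
  assumes "\<And>x. x \<in> verts G \<Longrightarrow> path_sum y (avoiding_first x k) \<le> c * path_sum y (paths_from G x)" and "x \<in> verts G"
  shows "path_sum y (avoiding_first x (n + k)) \<le> c * path_sum y (avoiding_first x n)"
  using assms(2)
proof (induction n arbitrary: x)
  case 0
  then show ?case using assms(1) by (simp add: avoiding_first_0)
next
  case (Suc n)
  have "path_sum y (avoiding_first x (Suc n + k)) \<le>
     (\<integral>\<^sup>+e. c * (ennreal (exp (y e)) * path_sum y (avoiding_first (head G e) n)) \<partial>count_space (avoiding_arcs x))"
    unfolding add_Suc avoiding_first_Suc path_sum_Cons_UN mult.left_commute[of c]
    by (intro nn_integral_mono mult_left_mono Suc.IH) (auto dest: avoiding_arcs_verts)
  also have "\<dots> = c * path_sum y (avoiding_first x (Suc n))"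
    unfolding avoiding_first_Suc path_sum_Cons_UN by (rule nn_integral_cmult) simp
  finally show ?case .
qed

lemma avoiding_first_power:
  assumes "\<And>x. x \<in> verts G \<Longrightarrow> path_sum y (avoiding_first x k) \<le> c * path_sum y (paths_from G x)" and "x \<in> verts G"
  shows "path_sum y (avoiding_first x (j * k)) \<le> c ^ j * path_sum y (paths_from G x)"
proof (induction j)
  case (Suc j)
  have "path_sum y (avoiding_first x (j * k + k)) \<le> c * path_sum y (avoiding_first x (j * k))"
    by (rule avoiding_first_add) (use assms in auto)
  also have "\<dots> \<le> c * (c ^ j * path_sum y (paths_from G x))"
    by (intro mult_left_mono Suc.IH) simp
  finally show ?case by (simp add: add.commute mult.assoc)
qed (simp add: avoiding_first_0)

text \<open>The free continuation contributes a factor of at least \<open>c\<close> wherever the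
  first \<open>n\<close> arcs end.\<close>

lemma avoiding_le_avoiding_first:
  assumes "\<And>x. x \<in> verts G \<Longrightarrow> c \<le> path_sum y (paths_from G x)" and "x \<in> verts G"
  shows "path_sum y (avoiding x n) * c \<le> path_sum y (avoiding_first x n)"
  using assms(2)
proof (induction n arbitrary: x)
  case 0
  then show ?case using assms(1) by (simp add: avoiding_first_0 avoiding_0)
next
  case (Suc n)
  have "path_sum y (avoiding x (Suc n)) * c =
     (\<integral>\<^sup>+e. ennreal (exp (y e)) * path_sum y (avoiding (head G e) n) * c \<partial>count_space (avoiding_arcs x))"
    unfolding avoiding_Suc path_sum_Cons_UN by (rule nn_integral_multc[symmetric]) simp
  also have "\<dots> \<le> path_sum y (avoiding_first x (Suc n))"
    unfolding avoiding_first_Suc path_sum_Cons_UN mult.assoc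
    by (intro nn_integral_mono mult_left_mono Suc.IH) (auto dest: avoiding_arcs_verts)
  finally show ?case .
qed

text \<open>There is no free continuation here, so no partition function has to be finite and the
  estimate can be used below \<open>h\<close>.\<close>

lemma avoiding_add:
  assumes "\<And>x. x \<in> verts G \<Longrightarrow> path_sum y (avoiding x k) \<le> c" and "x \<in> verts G"
  shows "path_sum y (avoiding x (n + k)) \<le> path_sum y (avoiding x n) * c"
  using assms(2)
proof (induction n arbitrary: x)
  case 0
  then show ?case using assms(1) by (simp add: avoiding_0)
next
  case (Suc n)
  have "path_sum y (avoiding x (Suc n + k)) \<le>
     (\<integral>\<^sup>+e. ennreal (exp (y e)) * path_sum y (avoiding (head G e) n) * c \<partial>count_space (avoiding_arcs x))"
    unfolding add_Suc avoiding_Suc path_sum_Cons_UN mult.assoc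
    by (intro nn_integral_mono mult_left_mono Suc.IH) (auto dest: avoiding_arcs_verts)
  also have "\<dots> = path_sum y (avoiding x (Suc n)) * c"
    unfolding avoiding_Suc path_sum_Cons_UN by (rule nn_integral_multc) simp
  finally show ?case .
qed

text \<open>
  A Doeblin argument: from any vertex the root is reached within \<open>k\<close> arcs at length at most \<open>D\<close>, so requiring
  \<open>k\<close> further arcs to avoid the root loses a fixed fraction of \<open>partition_fun\<close>, uniformly in \<open>\<sigma>\<close>.
\<close>

lemma avoiding_uniformly_small:
  assumes h: "0 < h" and fin: "\<And>\<sigma>. h < \<sigma> \<Longrightarrow> partition_fun \<sigma> v < \<infinity>"
  shows "\<exists>n>0. \<forall>\<sigma>. h < \<sigma> \<longrightarrow> \<sigma> \<le> h + 1 \<longrightarrow> (\<forall>x\<in>verts G. len_sum \<sigma> (avoiding x n) \<le> ennreal (1 / 2))"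
proof -
  obtain K where K: "K \<ge> 1" "\<And>\<sigma> x. h \<le> \<sigma> \<Longrightarrow> \<sigma> \<le> h + 1 \<Longrightarrow> x \<in> verts G \<Longrightarrow> partition_fun \<sigma> x \<le> ennreal K * partition_fun \<sigma> v"
    using partition_fun_le_root[OF h] by blast
  obtain D where D: "D > 0" "\<And>x. x \<in> verts G \<Longrightarrow> \<exists>q. awalk x q v \<and> q \<noteq> [] \<and> total_len q \<le> D"
    using uniform_path_to_root by blast
  obtain k where k: "\<And>q. set q \<subseteq> arcs G \<Longrightarrow> total_len q \<le> D \<Longrightarrow> length q \<le> k"
    using length_bound by blast
  \<comment> \<open>A lower bound for the weight of a return path, whose length is at most
    \<open>D\<close>, for all \<open>\<sigma> \<le> h + 1\<close>.\<close>
  define d where "d = exp (- ((h + 1) * D))"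
  \<comment> \<open>The detour takes away at least \<open>d * partition_fun \<sigma> v\<close>,
    hence at least the fraction \<open>d / K\<close> of
    \<open>partition_fun \<sigma> x\<close>.\<close>
  define r where "r = 1 - d / K"
  have d: "0 < d" "d \<le> 1"
    unfolding d_def using h D(1) by auto
  have r: "0 \<le> r" "r < 1"
    unfolding r_def using d K(1) by (auto simp: field_simps)
  have "(\<lambda>j. K / d * r ^ j) \<longlonglongrightarrow> K / d * 0"
    by (intro tendsto_mult_left LIMSEQ_realpow_zero r)
  then have "eventually (\<lambda>j. K / d * r ^ j < 1 / 2) sequentially"
    by (rule order_tendstoD) simp
  then obtain j0 where j0: "\<And>j. j \<ge> j0 \<Longrightarrow> K / d * r ^ j < 1 / 2"
    unfolding eventually_sequentially by blast
  define j where "j = Suc j0"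
  have j: "K / d * r ^ j \<le> 1 / 2" "j > 0"
    using j0[of j] by (auto simp: j_def)
  have "k > 0"
  proof -
    obtain q where "awalk v q v" "q \<noteq> []" "total_len q \<le> D"
      using D(2)[OF root] by blast
    then show ?thesis using k[of q] by (cases q) auto
  qed
  have "len_sum \<sigma> (avoiding x (j * k)) \<le> ennreal (1 / 2)"
    if \<sigma>: "h < \<sigma>" "\<sigma> \<le> h + 1" and x: "x \<in> verts G" for \<sigma> x
  proof -
    let ?u = "partition_fun \<sigma>"
    have path: "\<exists>q. awalk x q v \<and> q \<noteq> [] \<and> length q \<le> k \<and> d \<le> exp (- (\<sigma> * total_len q))" if "x \<in> verts G" for x
    proof -
      obtain q where q: "awalk x q v" "q \<noteq> []" "total_len q \<le> D"
        using D(2)[OF \<open>x \<in> verts G\<close>] by blast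
      have "\<sigma> * total_len q \<le> (h + 1) * D"
        using \<sigma> h q D(1) total_len_nonneg[of q] by (intro mult_mono) auto
      then show ?thesis
        using q k[of q] unfolding d_def by (intro exI[of _ q]) auto
    qed
    obtain u where u: "?u v = ennreal u" "u > 0"
    proof (cases "?u v" rule: ennreal_cases)
      case (real u)
      with partition_fun_ge_1[OF root, of \<sigma>] have "u \<ge> 1" by (simp add: ennreal_1[symmetric] del: ennreal_1)
      with real show ?thesis by (intro that) auto
    qed (use fin[OF \<sigma>(1)] in auto)
    have low: "ennreal d * ?u v \<le> ?u x" if x: "x \<in> verts G" for x
    proof -
      obtain q where q: "awalk x q v" "d \<le> exp (- (\<sigma> * total_len q))"
        using path[OF x] by blast
      have "ennreal d * ?u v \<le> ennreal (exp (- (\<sigma> * total_len q))) * ?u v"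
        using q(2) by (intro mult_right_mono ennreal_leI) auto
      also have "\<dots> \<le> ?u x"
        using path_sum_prefix_le[OF q(1), of "\<lambda>e. - (\<sigma> * len e)"] by simp
      finally show ?thesis .
    qed
    have contr: "len_sum \<sigma> (avoiding_first x k) \<le> ennreal r * ?u x" if x: "x \<in> verts G" for x
    proof -
      obtain q where q: "awalk x q v" "q \<noteq> []" "length q \<le> k" "d \<le> exp (- (\<sigma> * total_len q))"
        using path[OF x] by blast
      have "?u x \<le> ennreal K * ennreal u"
        using K(2)[OF _ \<sigma>(2) x] \<sigma>(1) u(1) by simp
      then have "?u x \<le> ennreal (K * u)"
        using K(1) u(2) by (simp add: ennreal_mult)
      then obtain w where w: "?u x = ennreal w" "w \<ge> 0" "w \<le> K * u"
        by (cases "?u x" rule: ennreal_cases) (use K(1) u(2) in \<open>auto simp: top_unique\<close>)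
      have "len_sum \<sigma> (avoiding_first x k) + ennreal (d * u) \<le> len_sum \<sigma> (avoiding_first x k) + ennreal (exp (- (\<sigma> * total_len q))) * ?u v"
        using q(4) d u by (auto simp: ennreal_mult[symmetric] intro!: add_left_mono ennreal_leI)
      also have "\<dots> \<le> ennreal w"
        using avoiding_first_detour[OF q(1-3), of \<sigma>] w(1) by simp
      finally have le: "len_sum \<sigma> (avoiding_first x k) + ennreal (d * u) \<le> ennreal w" .
      have "len_sum \<sigma> (avoiding_first x k) \<le> len_sum \<sigma> (avoiding_first x k) + ennreal (d * u)"
        by simp
      with le have "len_sum \<sigma> (avoiding_first x k) \<le> ennreal w"
        by (rule order_trans[rotated])
      then obtain b where b: "len_sum \<sigma> (avoiding_first x k) = ennreal b" "b \<ge> 0"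
        by (cases "len_sum \<sigma> (avoiding_first x k)" rule: ennreal_cases) (auto simp: top_unique)
      have "b + d * u \<le> w"
        using le b d u w by (simp add: ennreal_plus[symmetric] del: ennreal_plus)
      moreover have "d / K * w \<le> d / K * (K * u)"
        using w(3) d K(1) by (intro mult_left_mono) auto
      ultimately have "b \<le> r * w"
        using K(1) unfolding r_def by (simp add: algebra_simps)
      then show ?thesis
        using b w r by (simp add: ennreal_mult[symmetric] ennreal_leI)
    qed
    have "len_sum \<sigma> (avoiding x (j * k)) * ennreal (d * u) \<le> len_sum \<sigma> (avoiding_first x (j * k))"
      by (rule avoiding_le_avoiding_first[OF _ x]) (use low u d in \<open>auto simp: ennreal_mult\<close>)
    also have "\<dots> \<le> ennreal r ^ j * ?u x"
      by (rule avoiding_first_power[OF contr x])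
    also have "\<dots> \<le> ennreal r ^ j * (ennreal K * ennreal u)"
      using K(2)[OF _ \<sigma>(2) x] \<sigma>(1) u(1) by (intro mult_left_mono) auto
    also have "\<dots> = ennreal (r ^ j * K * u)"
      using r K(1) u(2) by (simp add: ennreal_mult ennreal_power mult.assoc)
    finally have le: "len_sum \<sigma> (avoiding x (j * k)) * ennreal (d * u) \<le> ennreal (r ^ j * K * u)" .
    show ?thesis
    proof (cases "len_sum \<sigma> (avoiding x (j * k))" rule: ennreal_cases)
      case (real a)
      have "ennreal (a * (d * u)) \<le> ennreal (r ^ j * K * u)"
        using le real d u by (simp add: ennreal_mult)
      then have "a * (d * u) \<le> r ^ j * K * u"
        using r K(1) u(2) by (subst (asm) ennreal_le_iff) auto
      \<comment> \<open>The value \<open>u\<close> may be unbounded as \<open>\<sigma>\<close>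
        decreases to \<open>h\<close>; its cancellation makes the bound uniform. The factor
        \<open>K / d\<close> in the choice of \<open>j\<close> comes from here.\<close>
      then have "a * d \<le> r ^ j * K"
        using u(2) by (simp add: mult.assoc[symmetric])
      then have "a \<le> K / d * r ^ j"
        using d by (simp add: field_simps)
      with j(1) have "a \<le> 1 / 2"
        by linarith
      with real(2) show ?thesis
        by (metis ennreal_leI)
    next
      case top
      then show ?thesis
        using le d u by (simp add: ennreal_top_mult top_unique)
    qed
  qed
  then show ?thesis
    using \<open>k > 0\<close> j(2) by (intro exI[of _ "j * k"]) auto
qed

section \<open>Perturbation below the abscissa of convergence\<close>

definition nonreturning :: "'b awalk set" where
  "nonreturning = {p \<in> paths_from G v. v \<notin> head G ` set p}"

text \<open>Consecutive arcs need not be composable, so the weighted sum is exactly a power of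
  \<open>arc_sum\<close>.\<close>

definition arc_lists :: "nat \<Rightarrow> 'b list set" where
  "arc_lists n = {p. set p \<subseteq> arcs G \<and> length p = n}"

lemma len_sum_arc_lists: "0 < \<sigma> \<Longrightarrow> len_sum \<sigma> (arc_lists n) = ennreal (arc_sum \<sigma> ^ n)"
proof (induction n)
  case 0
  have "arc_lists 0 = {[]}" by (auto simp: arc_lists_def)
  then show ?case by simp
next
  case (Suc n)
  have "arc_lists (Suc n) = (\<Union>e\<in>arcs G. (#) e ` arc_lists n)"
    by (rule set_eqI, rename_tac p, case_tac p) (auto simp: arc_lists_def)
  then have "len_sum \<sigma> (arc_lists (Suc n)) = (\<integral>\<^sup>+e. ennreal (exp (- (\<sigma> * len e))) * len_sum \<sigma> (arc_lists n) \<partial>count_space (arcs G))"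
    by (simp add: path_sum_Cons_UN)
  also have "\<dots> = ennreal (arc_sum \<sigma>) * len_sum \<sigma> (arc_lists n)"
    using Suc.prems by (subst nn_integral_multc) (auto simp: nn_integral_arc_sum)
  finally show ?case
    using Suc arc_sum_nonneg by (simp add: ennreal_mult)
qed

lemma avoiding_subset_arc_lists: "avoiding x n \<subseteq> arc_lists n"
  by (auto simp: avoiding_def arc_lists_def dest: paths_from_arcs)

text \<open>The arc lists outside \<open>avoiding x n\<close> also lose weight as the exponent
  grows, so the change on \<open>avoiding x n\<close> is at most the change on all arc lists. Both
  sides are sums to avoid subtraction in \<open>ennreal\<close>.\<close>

lemma avoiding_perturb:
  assumes "0 < \<sigma>" "\<sigma> \<le> \<tau>"
  shows "len_sum \<sigma> (avoiding x n) + ennreal (arc_sum \<tau> ^ n) \<le> len_sum \<tau> (avoiding x n) + ennreal (arc_sum \<sigma> ^ n)"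
proof -
  let ?A = "avoiding x n" and ?R = "arc_lists n - avoiding x n"
  have split: "ennreal (arc_sum \<rho> ^ n) = len_sum \<rho> ?A + len_sum \<rho> ?R" if "0 < \<rho>" for \<rho>
    using avoiding_subset_arc_lists[of x n]
    by (simp add: len_sum_arc_lists[OF that, symmetric] path_sum_Un[symmetric] Un_absorb1)
  have "len_sum \<tau> ?R \<le> len_sum \<sigma> ?R"
    by (rule len_sum_antimono) (use assms in \<open>auto simp: arc_lists_def\<close>)
  then show ?thesis
    using assms by (simp add: split add_left_mono add_ac)
qed

text \<open>
  Uniformity in \<open>\<sigma> > h\<close> allows a step below \<open>h\<close>: by \<open>avoiding_perturb\<close> the change is controlled by
  \<open>arc_sum\<close>, which is continuous on all of \<open>(0, \<infinity>)\<close> by G1.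
\<close>

lemma nonreturning_gap:
  assumes h: "0 < h" and fin: "\<And>\<sigma>. h < \<sigma> \<Longrightarrow> partition_fun \<sigma> v < \<infinity>"
  shows "\<exists>\<sigma>>0. \<sigma> < h \<and> len_sum \<sigma> nonreturning < \<infinity>"
proof -
  obtain n where n: "n > 0" "\<And>\<sigma> x. h < \<sigma> \<Longrightarrow> \<sigma> \<le> h + 1 \<Longrightarrow> x \<in> verts G \<Longrightarrow> len_sum \<sigma> (avoiding x n) \<le> ennreal (1 / 2)"
    using avoiding_uniformly_small[OF h fin] by blast
  have "isCont (\<lambda>\<sigma>. arc_sum \<sigma> ^ n) h"
    by (intro isCont_power isCont_arc_sum h)
  then obtain \<delta> where \<delta>: "\<delta> > 0" "\<And>\<sigma>. \<bar>\<sigma> - h\<bar> < \<delta> \<Longrightarrow> \<bar>arc_sum \<sigma> ^ n - arc_sum h ^ n\<bar> < 1 / 8"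
    unfolding continuous_at_eps_delta dist_real_def by (metis zero_less_divide_1_iff zero_less_numeral)
  \<comment> \<open>The three bounds are for continuity at \<open>h\<close>, for
    \<open>\<sigma> > 0\<close>, and for \<open>\<tau> \<le> h + 1\<close>.\<close>
  define s where "s = min (\<delta> / 2) (min (h / 2) 1)"
  define \<sigma> where "\<sigma> = h - s"
  define \<tau> where "\<tau> = h + s"
  have s: "0 < s" "s < \<delta>" "s < h" "s \<le> 1"
    unfolding s_def using \<delta>(1) h by auto
  have \<sigma>: "0 < \<sigma>" "\<sigma> < h" and \<tau>: "h < \<tau>" "\<tau> \<le> h + 1"
    unfolding \<sigma>_def \<tau>_def using s by auto
  have "\<bar>arc_sum \<sigma> ^ n - arc_sum h ^ n\<bar> < 1 / 8" "\<bar>arc_sum \<tau> ^ n - arc_sum h ^ n\<bar> < 1 / 8"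
    by (intro \<delta>(2); use s in \<open>simp add: \<sigma>_def \<tau>_def\<close>)+
  \<comment> \<open>Two errors of 1/8 add up to 1/4, and 1/2 + 1/4 is still below 1.\<close>
  then have diff: "arc_sum \<sigma> ^ n \<le> arc_sum \<tau> ^ n + 1 / 4"
    by linarith
  define z where "z m = enn2real (len_sum \<sigma> (avoiding v m))" for m
  have finm: "len_sum \<sigma> (avoiding x m) \<le> ennreal (arc_sum \<sigma> ^ m)" for x m
    using path_sum_mono[OF avoiding_subset_arc_lists] len_sum_arc_lists[OF \<sigma>(1)] by metis
  then have z: "len_sum \<sigma> (avoiding v m) = ennreal (z m)" for m
    unfolding z_def by (metis ennreal_enn2real ennreal_less_top order_le_less_trans)
  have z0: "0 \<le> z m" for m
    by (simp add: z_def)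
  have small: "len_sum \<sigma> (avoiding x n) \<le> ennreal (3 / 4)" if "x \<in> verts G" for x
  proof -
    have "len_sum \<sigma> (avoiding x n) + ennreal (arc_sum \<tau> ^ n) \<le> len_sum \<tau> (avoiding x n) + ennreal (arc_sum \<sigma> ^ n)"
      by (rule avoiding_perturb) (use \<sigma> \<tau> in auto)
    also have "\<dots> \<le> ennreal (1 / 2) + ennreal (arc_sum \<tau> ^ n + 1 / 4)"
      by (intro add_mono n(2)[OF \<tau> that] ennreal_leI diff)
    also have "\<dots> = ennreal (3 / 4) + ennreal (arc_sum \<tau> ^ n)"
    proof -
      have "ennreal (1 / 2) + ennreal (arc_sum \<tau> ^ n + 1 / 4) = ennreal (1 / 2 + (arc_sum \<tau> ^ n + 1 / 4))"
        by (rule ennreal_plus[symmetric]) (use arc_sum_nonneg in auto)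
      also have "1 / 2 + (arc_sum \<tau> ^ n + 1 / 4) = 3 / 4 + arc_sum \<tau> ^ n"
        by simp
      also have "ennreal \<dots> = ennreal (3 / 4) + ennreal (arc_sum \<tau> ^ n)"
        by (rule ennreal_plus) (use arc_sum_nonneg in auto)
      finally show ?thesis .
    qed
    finally show ?thesis
      by (simp add: ennreal_add_left_cancel_le add.commute)
  qed
  have zn: "z (m + n) \<le> 3 / 4 * z m" for m
  proof -
    have "len_sum \<sigma> (avoiding v (m + n)) \<le> len_sum \<sigma> (avoiding v m) * ennreal (3 / 4)"
      by (rule avoiding_add) (use small root in auto)
    also have "\<dots> = ennreal (z m * (3 / 4))"
      unfolding z by (rule ennreal_mult[symmetric]) (use z0 in auto)
    finally have "ennreal (z (m + n)) \<le> ennreal (z m * (3 / 4))"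
      unfolding z .
    then show ?thesis
      using z0[of m] by (subst (asm) ennreal_le_iff) auto
  qed
  define S where "S N = (\<Sum>m<N. z m)" for N
  \<comment> \<open>Shifting the index by \<open>n\<close> gives
    \<open>S N \<le> S n + 3 / 4 * S N\<close>, which is solved for the finite sum
    \<open>S N\<close>.\<close>
  have S: "S N \<le> 4 * S n" for N
  proof -
    have "S N \<le> S (n + N)"
      unfolding S_def by (rule sum_mono2) (use z0 in auto)
    also have "\<dots> = S n + (\<Sum>m<N. z (m + n))"
      unfolding S_def by (induction N) (simp_all add: add_ac)
    also have "\<dots> \<le> S n + (\<Sum>m<N. 3 / 4 * z m)"
      by (intro add_left_mono sum_mono zn)
    also have "\<dots> = S n + 3 / 4 * S N"
      unfolding S_def by (simp add: sum_distrib_left)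
    finally show ?thesis by simp
  qed
  have "nonreturning = (\<Union>N. \<Union>m\<in>{..<N}. avoiding v m)"
    by (auto simp: nonreturning_def avoiding_def)
  moreover have "len_sum \<sigma> (\<Union>N. \<Union>m\<in>{..<N}. avoiding v m) \<le> ennreal (4 * S n)"
  proof (rule path_sum_UN_bound)
    show "incseq (\<lambda>N. \<Union>m\<in>{..<N}. avoiding v m)"
      by (force simp: incseq_def)
    fix N
    have "len_sum \<sigma> (\<Union>m\<in>{..<N}. avoiding v m) \<le> (\<Sum>m<N. len_sum \<sigma> (avoiding v m))"
      by (rule path_sum_UN_le)
    also have "\<dots> = ennreal (S N)"
      unfolding S_def z using z0 by (simp add: sum_ennreal)
    also have "\<dots> \<le> ennreal (4 * S n)"
      by (intro ennreal_leI S)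
    finally show "len_sum \<sigma> (\<Union>m\<in>{..<N}. avoiding v m) \<le> ennreal (4 * S n)" .
  qed
  ultimately have "len_sum \<sigma> nonreturning < \<infinity>"
    by (auto intro: le_less_trans)
  with \<sigma> show ?thesis by blast
qed

section \<open>First-return loops and the growth rate\<close>

definition first_returns :: "'b awalk set" where
  "first_returns = {p. awalk v p v \<and> p \<noteq> [] \<and> v \<notin> head G ` set (butlast p)}"

lemma first_returns_arcs: "p \<in> first_returns \<Longrightarrow> set p \<subseteq> arcs G"
  by (auto simp: first_returns_def)

text \<open>First-return loops form a prefix code: the last arc of \<open>p\<close> enters the root,
  which a proper extension could not do before its own last arc. Hence the factorisation into loops
  is unique.\<close>

lemma first_return_prefix:
  assumes "p \<in> first_returns" "p @ u \<in> first_returns"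
  shows "u = []"
proof (rule ccontr)
  assume "u \<noteq> []"
  then have "butlast (p @ u) = p @ butlast u"
    by (simp add: butlast_append)
  moreover have "last p \<in> set p" "head G (last p) = v"
    using assms(1) awalk_ends(2)[of v p v] by (auto simp: first_returns_def)
  ultimately have "v \<in> head G ` set (butlast (p @ u))"
    by force
  with assms(2) show False by (simp add: first_returns_def)
qed

lemma inj_on_first_returns_append: "inj_on (\<lambda>(p, q). p @ q) (first_returns \<times> X)"
proof -
  have unique: "p = p' \<and> q = q'" if pp: "p \<in> first_returns" "p' \<in> first_returns" "p @ q = p' @ q'" for p p' q q'
  proof -
    obtain u where u: "p = p' @ u \<and> u @ q = q' \<or> p @ u = p' \<and> q = u @ q'"
      using pp(3) by (auto simp: append_eq_append_conv2)
    with pp(1,2) have "u = []"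
      using first_return_prefix by blast
    with u show ?thesis by auto
  qed
  show ?thesis
  proof (rule inj_onI)
    fix z z' assume "z \<in> first_returns \<times> X" "z' \<in> first_returns \<times> X"
      "(case z of (p, q) \<Rightarrow> p @ q) = (case z' of (p, q) \<Rightarrow> p @ q)"
    then show "z = z'"
      using unique[of "fst z" "fst z'" "snd z" "snd z'"] by (cases z; cases z') auto
  qed
qed

lemma nonreturning_or_first_return:
  assumes "p \<in> paths_from G v"
  shows "p \<in> nonreturning \<or> (\<exists>g\<in>first_returns. \<exists>q\<in>paths_from G v. p = g @ q)"
proof (cases "\<exists>e\<in>set p. head G e = v")
  case True
  then obtain g e q where p: "p = g @ e # q" "head G e = v" "\<forall>f\<in>set g. head G f \<noteq> v"
    using split_list_first_prop[of p "\<lambda>e. head G e = v"] by blast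
  have "awalk v (g @ [e]) v" "q \<in> paths_from G v"
    using assms p by (auto simp: paths_from_def awalk_Cons_iff awalk_Nil_iff)
  then show ?thesis
    using p by (intro disjI2 bexI[of _ "g @ [e]"] bexI[of _ q]) (auto simp: first_returns_def)
next
  case False
  then show ?thesis using assms by (auto simp: nonreturning_def)
qed

lemma closed_walk_decomposition:
  assumes "awalk v p v"
  shows "\<exists>gs. set gs \<subseteq> first_returns \<and> p = concat gs"
  using assms
proof (induction p rule: length_induct)
  case (1 p)
  show ?case
  proof (cases "p = []")
    case True
    then show ?thesis by (intro exI[of _ "[]"]) simp
  next
    case False
    then have "p \<notin> nonreturning"
      using awalk_ends(2)[OF 1(2)] by (force simp: nonreturning_def)
    moreover have "p \<in> paths_from G v"
      using 1(2) by (auto simp: paths_from_def)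
    ultimately obtain g q where g: "g \<in> first_returns" "p = g @ q"
      using nonreturning_or_first_return by blast
    then have "awalk v q v" "length q < length p"
      using 1(2) by (auto simp: first_returns_def)
    then obtain gs where "set gs \<subseteq> first_returns" "q = concat gs"
      using 1(1) by blast
    with g show ?thesis by (intro exI[of _ "g # gs"]) simp
  qed
qed

text \<open>If \<open>g\<close> were the only loop, every closed walk at the root would be a power
  of \<open>g\<close>, and all closed lengths would be multiples of \<open>total_len g\<close>,
  against G3.\<close>

lemma two_first_returns: "\<exists>g\<in>first_returns. \<exists>g'\<in>first_returns. g \<noteq> g'"
proof -
  obtain q where q: "awalk v q v" "q \<noteq> []"
    using uniform_path_to_root root by blast
  then obtain gs where "set gs \<subseteq> first_returns" "q = concat gs"
    using closed_walk_decomposition by blast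
  with q(2) obtain g where g: "g \<in> first_returns"
    by (cases gs) auto
  show ?thesis
  proof (rule ccontr)
    assume "\<not> ?thesis"
    with g have only: "first_returns = {g}" by blast
    define d where "d = total_len g"
    have d: "d > 0"
      unfolding d_def using g by (intro total_len_pos) (auto simp: first_returns_def)
    have mult: "\<exists>n::nat. total_len p = d * real n" if p: "awalk v p v" for p
    proof -
      obtain gs where "set gs \<subseteq> {g}" "p = concat gs"
        using closed_walk_decomposition[OF p] only by blast
      then have "total_len p = d * real (length gs)"
        unfolding d_def by (induction gs arbitrary: p) (auto simp: algebra_simps)
      then show ?thesis ..
    qed
    \<comment> \<open>A closed walk elsewhere is inserted into the closed walk \<open>a @ b\<close>
      at the root. Positivity of \<open>total_len p\<close> orders the two multiples, so their
      difference is again a natural multiple.\<close>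
    have "\<exists>n::nat. total_len p = d * real n" if p: "awalk x p x" "p \<noteq> []" for x p
    proof -
      obtain a b where ab: "awalk v a x" "awalk x b v"
        using strongly_connected_walks root p(1) awalk_hd_in_verts by metis
      obtain n n' :: nat where n: "total_len (a @ b) = d * real n" "total_len (a @ p @ b) = d * real n'"
        using mult ab p(1) by (meson awalk_appendI)
      then have eq: "total_len p = d * (real n' - real n)"
        by (simp add: algebra_simps)
      have "total_len p > 0"
        using p by (intro total_len_pos) auto
      with eq d have "n < n'"
        by (simp add: zero_less_mult_iff)
      with eq have "total_len p = d * real (n' - n)"
        by (simp add: of_nat_diff)
      then show ?thesis ..
    qed
    then have "{awalk_cost len p | p. closed_w p} \<subseteq> {d * real n | n. True}"
      by (fastforce simp: closed_w_def awalk_cost_def)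
    with G3 d show False unfolding G3_def by blast
  qed
qed

text \<open>The empty path and the paths that begin with a loop are disjoint families. This half of
  the renewal equation suffices to rule out a first-return sum of at least 1 when the total is
  finite.\<close>

lemma path_sum_renewal_ge:
  "1 + path_sum y first_returns * path_sum y (paths_from G v) \<le> path_sum y (paths_from G v)"
proof -
  let ?FP = "(\<lambda>(p, q). p @ q) ` (first_returns \<times> paths_from G v)"
  have "1 + path_sum y first_returns * path_sum y (paths_from G v) = path_sum y {[]} + path_sum y ?FP"
    by (simp add: path_sum_append[OF inj_on_first_returns_append])
  also have "\<dots> = path_sum y ({[]} \<union> ?FP)"
    by (rule path_sum_Un[symmetric]) (auto simp: first_returns_def)
  also have "\<dots> \<le> path_sum y (paths_from G v)"
    by (rule path_sum_mono) (use root append_in_paths_from in \<open>auto simp: first_returns_def\<close>)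
  finally show ?thesis .
qed

lemma path_sum_first_returns_less_1:
  assumes "path_sum y (paths_from G v) < \<infinity>"
  shows "path_sum y first_returns < 1"
proof (rule ccontr)
  assume "\<not> ?thesis"
  then have "1 * path_sum y (paths_from G v) \<le> path_sum y first_returns * path_sum y (paths_from G v)"
    by (intro mult_right_mono) auto
  then have "1 + path_sum y (paths_from G v) \<le> 1 + path_sum y first_returns * path_sum y (paths_from G v)"
    by (simp add: add_left_mono)
  then have "1 + path_sum y (paths_from G v) \<le> path_sum y (paths_from G v)"
    using path_sum_renewal_ge by (rule order_trans)
  with assms show False
    by (cases "path_sum y (paths_from G v)" rule: ennreal_cases)
      (auto simp: ennreal_plus[symmetric] ennreal_1[symmetric] simp del: ennreal_plus ennreal_1)
qed

lemma path_sum_paths_finite: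
  assumes F: "path_sum y first_returns < 1" and Q: "path_sum y nonreturning < \<infinity>"
  shows "path_sum y (paths_from G v) < \<infinity>"
proof -
  obtain f where f: "path_sum y first_returns = ennreal f" "0 \<le> f" "f < 1"
    using F by (cases "path_sum y first_returns" rule: ennreal_cases) (auto simp flip: ennreal_1 simp: ennreal_less_iff)
  obtain g where g: "path_sum y nonreturning = ennreal g" "0 \<le> g"
    using Q by (cases "path_sum y nonreturning" rule: ennreal_cases) auto
  \<comment> \<open>The fixed point of \<open>B = g + f * B\<close>. The induction bounds the number
    of arcs, which drops by at least one whenever a loop is removed.\<close>
  define B where "B = g / (1 - f)"
  have B: "0 \<le> B" "g + f * B = B"
    unfolding B_def using f g by (auto simp: field_simps)
  let ?A = "\<lambda>n. {p \<in> paths_from G v. length p < n}"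
  have step: "path_sum y (?A n) \<le> ennreal B" for n
  proof (induction n)
    case 0
    then show ?case by simp
  next
    case (Suc n)
    have "?A (Suc n) \<subseteq> nonreturning \<union> (\<lambda>(p, q). p @ q) ` (first_returns \<times> ?A n)"
    proof
      fix p assume p: "p \<in> ?A (Suc n)"
      show "p \<in> nonreturning \<union> (\<lambda>(p, q). p @ q) ` (first_returns \<times> ?A n)"
      proof (cases "p \<in> nonreturning")
        case False
        then obtain g q where gq: "g \<in> first_returns" "q \<in> paths_from G v" "p = g @ q"
          using p nonreturning_or_first_return by blast
        then have "g \<noteq> []" by (simp add: first_returns_def)
        with p gq(3) have "length q < n" by (cases g) auto
        with gq show ?thesis by force
      qed simp
    qed
    then have "path_sum y (?A (Suc n)) \<le> path_sum y (nonreturning \<union> (\<lambda>(p, q). p @ q) ` (first_returns \<times> ?A n))"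
      by (rule path_sum_mono)
    also have "\<dots> \<le> path_sum y nonreturning + path_sum y ((\<lambda>(p, q). p @ q) ` (first_returns \<times> ?A n))"
      by (rule path_sum_Un_le)
    also have "\<dots> = ennreal g + ennreal f * path_sum y (?A n)"
      by (simp add: path_sum_append[OF inj_on_first_returns_append] f g)
    also have "\<dots> \<le> ennreal g + ennreal f * ennreal B"
      by (intro add_left_mono mult_left_mono Suc.IH) auto
    also have "\<dots> = ennreal B"
      using B f g by (simp add: ennreal_mult[symmetric] ennreal_plus[symmetric] del: ennreal_plus)
    finally show ?case .
  qed
  have "path_sum y (paths_from G v) = path_sum y (\<Union>n. ?A n)"
    by (rule arg_cong[where f = "path_sum y"]) auto
  also have "\<dots> \<le> ennreal B"
    by (rule path_sum_UN_bound) (use step in \<open>auto simp: incseq_def\<close>)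
  finally show ?thesis by (auto intro: le_less_trans)
qed

text \<open>Dropping the last arc of a loop leaves a nonreturning path, and the arc itself costs a
  factor of at most \<open>arc_sum \<sigma>\<close>.\<close>

lemma first_returns_finite:
  assumes "0 < \<sigma>" "len_sum \<sigma> nonreturning < \<infinity>"
  shows "len_sum \<sigma> first_returns < \<infinity>"
proof -
  have "first_returns \<subseteq> (\<lambda>(p, q). p @ q) ` (nonreturning \<times> arc_lists 1)"
  proof
    fix g assume g: "g \<in> first_returns"
    then have ne: "g \<noteq> []" by (simp add: first_returns_def)
    have "awalk v (butlast g @ [last g]) v"
      using g ne by (simp add: first_returns_def)
    then have "butlast g \<in> paths_from G v" "last g \<in> arcs G"
      by (auto simp: paths_from_def awalk_Cons_iff)
    with g have "(butlast g, [last g]) \<in> nonreturning \<times> arc_lists 1"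
      by (auto simp: nonreturning_def first_returns_def arc_lists_def)
    then show "g \<in> (\<lambda>(p, q). p @ q) ` (nonreturning \<times> arc_lists 1)"
      using ne by (intro image_eqI[of _ _ "(butlast g, [last g])"]) auto
  qed
  then have "len_sum \<sigma> first_returns \<le> len_sum \<sigma> ((\<lambda>(p, q). p @ q) ` (nonreturning \<times> arc_lists 1))"
    by (rule path_sum_mono)
  also have "\<dots> = len_sum \<sigma> nonreturning * ennreal (arc_sum \<sigma> ^ 1)"
    unfolding len_sum_arc_lists[OF assms(1), symmetric]
    by (rule path_sum_append) (auto simp: inj_on_def arc_lists_def)
  also have "\<dots> < \<infinity>"
    using assms(2) by (simp add: ennreal_mult_less_top)
  finally show ?thesis .
qed

section \<open>The critical exponent\<close>

lemma partition_fun_finite_large: "\<exists>\<sigma>>0. partition_fun \<sigma> v < \<infinity>"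
proof -
  obtain m where m: "m > 0" "\<And>e. e \<in> arcs G \<Longrightarrow> m \<le> len e"
    using uniform_len_bound by blast
  define A where "A = arc_sum 1"
  have A: "0 \<le> A" by (simp add: A_def arc_sum_nonneg)
  \<comment> \<open>All arcs have length at least \<open>m\<close>, so raising the exponent from 1
    by \<open>2 * A / m\<close> multiplies the arc sum by at most \<open>exp (- (2 * A))\<close>,
    and \<open>exp (- (2 * A)) * A \<le> 1 / 2\<close>.\<close>
  define \<sigma> where "\<sigma> = 1 + 2 * A / m"
  have \<sigma>: "\<sigma> \<ge> 1" unfolding \<sigma>_def using A m(1) by simp
  have "exp (- (\<sigma> * len e)) \<le> exp (- (2 * A)) * exp (- (1 * len e))" if "e \<in> arcs G" for e
  proof -
    have "2 * A / m * m \<le> 2 * A / m * len e"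
      using m A that by (intro mult_left_mono) auto
    then show ?thesis
      using m(1) by (simp add: mult_exp_exp \<sigma>_def algebra_simps)
  qed
  then have "arc_sum \<sigma> \<le> (\<Sum>\<^sub>\<infinity>e\<in>arcs G. exp (- (2 * A)) * exp (- (1 * len e)))"
    unfolding arc_sum_def
    by (intro infsum_mono arc_sum_summable summable_on_cmult_right) (use \<sigma> in auto)
  also have "\<dots> = exp (- (2 * A)) * A"
    unfolding A_def arc_sum_def by (rule infsum_cmult_right) (use arc_sum_summable[of 1] in simp)
  also have "\<dots> \<le> 1 / 2"
  proof -
    have "2 * A \<le> exp (2 * A)"
      using exp_ge_add_one_self[of "2 * A"] by linarith
    then show ?thesis by (simp add: exp_minus field_simps)
  qed
  finally have half: "arc_sum \<sigma> \<le> 1 / 2" .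
  have "paths_from G v \<subseteq> (\<Union>N. \<Union>n\<in>{..<N}. arc_lists n)"
    by (auto simp: arc_lists_def dest!: paths_from_arcs)
  then have "partition_fun \<sigma> v \<le> len_sum \<sigma> (\<Union>N. \<Union>n\<in>{..<N}. arc_lists n)"
    by (rule path_sum_mono)
  also have "\<dots> \<le> ennreal 2"
  proof (rule path_sum_UN_bound)
    show "incseq (\<lambda>N. \<Union>n\<in>{..<N}. arc_lists n)"
      by (force simp: incseq_def)
    fix N
    have "len_sum \<sigma> (\<Union>n\<in>{..<N}. arc_lists n) \<le> (\<Sum>n<N. len_sum \<sigma> (arc_lists n))"
      by (rule path_sum_UN_le)
    also have "\<dots> = ennreal (\<Sum>n<N. arc_sum \<sigma> ^ n)"
      using \<sigma> arc_sum_nonneg by (simp add: len_sum_arc_lists sum_ennreal)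
    also have "\<dots> \<le> ennreal (\<Sum>n<N. (1 / 2) ^ n)"
      by (intro ennreal_leI sum_mono power_mono half arc_sum_nonneg)
    also have "\<dots> \<le> ennreal 2"
      by (intro ennreal_leI) (simp add: geometric_sum)
    finally show "len_sum \<sigma> (\<Union>n\<in>{..<N}. arc_lists n) \<le> ennreal 2" .
  qed
  finally have "partition_fun \<sigma> v < \<infinity>"
    by (auto intro: le_less_trans)
  with \<sigma> show ?thesis by (intro exI[of _ \<sigma>]) auto
qed

lemma critical_exponent_exists:
  "\<exists>h>0. (\<forall>\<sigma>>h. partition_fun \<sigma> v < \<infinity>) \<and> (\<forall>\<sigma>>0. \<sigma> < h \<longrightarrow> partition_fun \<sigma> v = \<infinity>)"
proof -
  obtain g g' where g: "g \<in> first_returns" "g' \<in> first_returns" "g \<noteq> g'"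
    using two_first_returns by blast
  define M where "M = max (total_len g) (total_len g')"
  have M: "M > 0"
    unfolding M_def using g(1) by (auto simp: less_max_iff_disj first_returns_def intro!: total_len_pos)
  \<comment> \<open>Below this exponent each of the two loops weighs at least 1/2, so the
    first-return sum reaches 1 and the partition function is infinite.\<close>
  define s where "s = ln 2 / M"
  have s: "s > 0" unfolding s_def using M by simp
  have inf: "s \<le> \<sigma>" if \<sigma>: "0 < \<sigma>" "partition_fun \<sigma> v < \<infinity>" for \<sigma>
  proof (rule ccontr)
    assume "\<not> s \<le> \<sigma>"
    have half: "1 / 2 \<le> exp (- (\<sigma> * total_len p))" if "total_len p \<le> M" for p
    proof -
      have "\<sigma> * total_len p \<le> \<sigma> * M"
        using that \<sigma>(1) by (intro mult_left_mono) auto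
      also have "\<dots> \<le> s * M"
        using \<open>\<not> s \<le> \<sigma>\<close> M by (intro mult_right_mono) auto
      also have "\<dots> = ln 2"
        unfolding s_def using M by simp
      finally have "exp (- ln 2) \<le> exp (- (\<sigma> * total_len p))"
        by simp
      then show ?thesis by (simp add: exp_minus)
    qed
    have "ennreal 1 \<le> ennreal (exp (- (\<sigma> * total_len g)) + exp (- (\<sigma> * total_len g')))"
      using half[of g] half[of g'] by (intro ennreal_leI) (auto simp: M_def)
    also have "\<dots> = len_sum \<sigma> ({g} \<union> {g'})"
      using g(3) by (subst path_sum_Un) (auto simp: ennreal_plus)
    also have "\<dots> \<le> len_sum \<sigma> first_returns"
      by (rule path_sum_mono) (use g in auto)
    also have "\<dots> < 1"
      by (rule path_sum_first_returns_less_1[OF \<sigma>(2)])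
    finally show False by simp
  qed
  define S where "S = {\<sigma>. 0 < \<sigma> \<and> partition_fun \<sigma> v < \<infinity>}"
  have S: "S \<noteq> {}" "bdd_below S"
    using partition_fun_finite_large inf by (auto simp: S_def intro!: bdd_belowI[of _ s])
  have "s \<le> Inf S"
    by (rule cInf_greatest[OF S(1)]) (use inf in \<open>auto simp: S_def\<close>)
  moreover have "partition_fun \<sigma> v < \<infinity>" if \<sigma>: "Inf S < \<sigma>" for \<sigma>
  proof -
    obtain \<tau> where \<tau>: "\<tau> \<in> S" "\<tau> < \<sigma>"
      using \<sigma> cInf_less_iff[OF S] by blast
    have "partition_fun \<sigma> v \<le> partition_fun \<tau> v"
      by (rule len_sum_antimono) (use \<tau> paths_from_arcs in auto)
    then show ?thesis
      using \<tau>(1) by (auto simp: S_def intro: le_less_trans)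
  qed
  moreover have "partition_fun \<sigma> v = \<infinity>" if "0 < \<sigma>" "\<sigma> < Inf S" for \<sigma>
  proof (rule ccontr)
    assume "partition_fun \<sigma> v \<noteq> \<infinity>"
    then have "\<sigma> \<in> S" using that by (simp add: S_def less_top)
    then show False using cInf_lower[OF _ S(2)] that by force
  qed
  ultimately show ?thesis
    using s by (intro exI[of _ "Inf S"]) auto
qed

text \<open>The gap makes the first-return sum continuous on both sides of \<open>h\<close>. From
  the right its value at \<open>h\<close> is at most 1. Were it smaller, it would stay below 1
  slightly to the left, and since nonreturning paths still converge there, so would the partition
  function, below its abscissa.\<close>

lemma growth_rate_exists:
  "\<exists>s h. 0 < s \<and> s < h \<and> len_sum s nonreturning < \<infinity> \<and> len_sum s first_returns < \<infinity> \<and>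
    len_sum h first_returns = 1 \<and> (\<forall>\<sigma>>h. partition_fun \<sigma> v < \<infinity>)"
proof -
  obtain h where h: "h > 0" "\<And>\<sigma>. \<sigma> > h \<Longrightarrow> partition_fun \<sigma> v < \<infinity>"
    and inf: "\<And>\<sigma>. 0 < \<sigma> \<Longrightarrow> \<sigma> < h \<Longrightarrow> partition_fun \<sigma> v = \<infinity>"
    using critical_exponent_exists by blast
  obtain s where s: "0 < s" "s < h" "len_sum s nonreturning < \<infinity>"
    using nonreturning_gap[OF h] by blast
  have sF: "len_sum s first_returns < \<infinity>"
    by (rule first_returns_finite[OF s(1,3)])
  define f where "f \<sigma> = (\<Sum>\<^sub>\<infinity>p\<in>first_returns. exp (- (\<sigma> * total_len p)))" for \<sigma>
  have f: "len_sum \<sigma> first_returns = ennreal (f \<sigma>)" "0 \<le> f \<sigma>" if "s \<le> \<sigma>" for \<sigma>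
  proof -
    have "len_sum \<sigma> first_returns \<le> len_sum s first_returns"
      by (rule len_sum_antimono) (use that first_returns_arcs in auto)
    then have "len_sum \<sigma> first_returns < \<infinity>"
      using sF by (rule le_less_trans)
    then show "len_sum \<sigma> first_returns = ennreal (f \<sigma>)"
      unfolding f_def by (simp add: path_sum_eq_infsum)
    show "0 \<le> f \<sigma>"
      unfolding f_def by (rule infsum_nonneg) simp
  qed
  have cont: "isCont f h"
  proof -
    have "exp (- (h * total_len p)) * exp ((h - s) * total_len p) = exp (- (s * total_len p))" for p
      by (simp add: mult_exp_exp algebra_simps)
    then have "(\<lambda>p. exp (- (h * total_len p)) * exp ((h - s) * total_len p)) summable_on first_returns"
      using sF unfolding path_sum_finite_iff by simp
    then have "((\<lambda>t. \<Sum>\<^sub>\<infinity>p\<in>first_returns. exp (- (h * total_len p)) * exp (t * - total_len p)) has_real_derivative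
        (\<Sum>\<^sub>\<infinity>p\<in>first_returns. exp (- (h * total_len p)) * - total_len p)) (at 0)"
      by (rule exp_moment_deriv[rotated 3]) (use s total_len_nonneg first_returns_arcs in auto)
    moreover have "exp (- (h * total_len p)) * exp (t * - total_len p) = exp (- ((h + t) * total_len p))" for t p
      by (simp add: mult_exp_exp algebra_simps)
    ultimately have "isCont (\<lambda>t. f (h + t)) 0"
      unfolding f_def by (simp only: DERIV_isCont)
    then show ?thesis
      by (simp add: isCont_iff)
  qed
  have lt: "f \<sigma> < 1" if "h < \<sigma>" for \<sigma>
  proof -
    have "ennreal (f \<sigma>) < ennreal 1"
      using path_sum_first_returns_less_1[OF h(2)[OF that]] f(1)[of \<sigma>] that s by simp
    then show ?thesis using f(2)[of \<sigma>] that s by (subst (asm) ennreal_less_iff) auto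
  qed
  have "f h \<le> 1"
  proof (rule tendsto_upperbound)
    show "(f \<longlongrightarrow> f h) (at_right h)"
      using cont unfolding isCont_def by (rule filterlim_mono) (auto simp: at_le)
    show "\<forall>\<^sub>F \<sigma> in at_right h. f \<sigma> \<le> 1"
      using lt by (auto simp: eventually_at_filter intro!: always_eventually less_imp_le)
  qed simp
  moreover have "\<not> f h < 1"
  proof
    assume "f h < 1"
    have "(f \<longlongrightarrow> f h) (at_left h)"
      using cont unfolding isCont_def by (rule filterlim_mono) (auto simp: at_le)
    then have "\<forall>\<^sub>F \<sigma> in at_left h. f \<sigma> < 1"
      using \<open>f h < 1\<close> by (rule order_tendstoD)
    then have "\<forall>\<^sub>F \<sigma> in at_left h. f \<sigma> < 1 \<and> s < \<sigma> \<and> \<sigma> < h"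
      using eventually_at_left_real[OF s(2)] by eventually_elim auto
    then obtain \<sigma> where \<sigma>: "f \<sigma> < 1" "s < \<sigma>" "\<sigma> < h"
      using eventually_happens[of _ "at_left h"] by (auto simp: trivial_limit_at_left_real)
    have "len_sum \<sigma> nonreturning \<le> len_sum s nonreturning"
      by (rule len_sum_antimono) (use \<sigma> paths_from_arcs in \<open>auto simp: nonreturning_def\<close>)
    then have "len_sum \<sigma> nonreturning < \<infinity>"
      using s(3) by (rule le_less_trans)
    moreover have "len_sum \<sigma> first_returns < 1"
      using f[of \<sigma>] \<sigma> by (simp add: ennreal_1[symmetric] ennreal_less_iff del: ennreal_1)
    ultimately have "partition_fun \<sigma> v < \<infinity>"
      by (intro path_sum_paths_finite)
    with inf[of \<sigma>] \<sigma> s show False by simp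
  qed
  ultimately have "f h = 1" by simp
  then have "len_sum h first_returns = 1"
    using f(1)[of h] s by simp
  with s sF h(2) show ?thesis by blast
qed

section \<open>Counting paths\<close>

abbreviation paths_less :: "real \<Rightarrow> 'b awalk set" where
  "paths_less T \<equiv> paths_from_less G len v T"

abbreviation path_count :: "real \<Rightarrow> real" where
  "path_count T \<equiv> real (card (paths_less T))"

lemma paths_less_iff: "p \<in> paths_less T \<longleftrightarrow> p \<in> paths_from G v \<and> total_len p < T"
  by (simp add: paths_from_less_def awalk_cost_def)

lemma finite_paths_less: "finite (paths_less T)"
proof -
  obtain \<sigma> where \<sigma>: "\<sigma> > 0" "partition_fun \<sigma> v < \<infinity>"
    using partition_fun_finite_large by blast
  then obtain K where K: "partition_fun \<sigma> v = ennreal K" "K \<ge> 0"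
    by (cases "partition_fun \<sigma> v" rule: ennreal_cases) auto
  have "len_sum \<sigma> (paths_less T) \<le> ennreal K"
    unfolding K(1)[symmetric] by (rule path_sum_mono) (auto simp: paths_less_iff)
  then show ?thesis
    by (rule path_sum_card_bound(1)[OF _ K(2), where r = "- (\<sigma> * T)"]) (use \<sigma> in \<open>auto simp: paths_less_iff\<close>)
qed

lemma Nil_in_paths_less: "0 < T \<Longrightarrow> [] \<in> paths_less T"
  using root by (simp add: paths_less_iff)

lemma path_count_ge_1:
  assumes "0 < T"
  shows "1 \<le> path_count T"
proof -
  have "card (paths_less T) \<noteq> 0"
    using Nil_in_paths_less[OF assms] finite_paths_less by (auto simp: card_eq_0_iff)
  then show ?thesis by simp
qed

lemma path_count_renewal:
  assumes "finite F" "F \<subseteq> first_returns"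
  shows "(\<Sum>g\<in>F. path_count (T - total_len g)) \<le> path_count T"
proof -
  let ?S = "SIGMA g:F. paths_less (T - total_len g)"
  have inj: "inj_on (\<lambda>(p, q). p @ q) ?S"
    by (rule inj_on_subset[OF inj_on_first_returns_append[of UNIV]]) (use assms in auto)
  have sub: "(\<lambda>(p, q). p @ q) ` ?S \<subseteq> paths_less T"
    using assms(2) append_in_paths_from by (auto simp: paths_less_iff first_returns_def)
  have "(\<Sum>g\<in>F. card (paths_less (T - total_len g))) = card ?S"
    using assms(1) finite_paths_less by (simp add: card_SigmaI)
  also have "\<dots> = card ((\<lambda>(p, q). p @ q) ` ?S)"
    by (rule card_image[OF inj, symmetric])
  also have "\<dots> \<le> card (paths_less T)"
    by (rule card_mono[OF finite_paths_less sub])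
  finally show ?thesis
    by (simp flip: of_nat_sum)
qed

text \<open>Finitely many loops suffice: their weights at \<open>a\<close> sum to at least 1, so
  prepending them to shorter paths reproduces a bound of the form
  \<open>\<kappa> * exp (a * T)\<close>.\<close>

lemma path_count_lower_bound:
  assumes h: "len_sum h first_returns = 1" and a: "0 \<le> a" "a < h"
  shows "\<exists>\<kappa>>0. \<forall>T>0. \<kappa> * exp (a * T) \<le> path_count T"
proof -
  obtain m where m: "m > 0" "\<And>e. e \<in> arcs G \<Longrightarrow> m \<le> len e"
    using uniform_len_bound by blast
  have long: "m \<le> total_len g" if "g \<in> first_returns" for g
  proof (cases g)
    case (Cons e p)
    then have "m \<le> len e" "0 \<le> total_len p"
      using m(2) first_returns_arcs[OF that] total_len_nonneg by auto
    with Cons show ?thesis by simp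
  qed (use that in \<open>auto simp: first_returns_def\<close>)
  have fin: "len_sum h first_returns < \<infinity>"
    by (simp add: h)
  let ?w = "\<lambda>p. exp (- (h * total_len p))"
  have sm: "?w summable_on first_returns"
    using fin unfolding path_sum_finite_iff by simp
  have "ennreal (infsum ?w first_returns) = ennreal 1"
    using path_sum_eq_infsum[OF fin] h by simp
  then have "infsum ?w first_returns = 1"
    by (subst (asm) ennreal_inj) (auto intro: infsum_nonneg)
  then have "(?w has_sum 1) first_returns"
    using has_sum_infsum[OF sm] by simp
  then have "(sum ?w \<longlongrightarrow> 1) (finite_subsets_at_top first_returns)"
    by (simp add: has_sum_def)
  moreover have "exp (- ((h - a) * m)) < 1"
    using a m by simp
  ultimately have "\<forall>\<^sub>F F in finite_subsets_at_top first_returns. exp (- ((h - a) * m)) < sum ?w F"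
    by (rule order_tendstoD)
  then obtain F where F: "finite F" "F \<subseteq> first_returns" "exp (- ((h - a) * m)) < sum ?w F"
    unfolding eventually_finite_subsets_at_top by blast
  \<comment> \<open>\<open>F\<close> nearly exhausts the weight at \<open>h\<close>, and every loop gains at least \<open>exp ((h - a) * m)\<close> at \<open>a\<close>.\<close>
  have supercritical: "1 \<le> (\<Sum>g\<in>F. exp (- (a * total_len g)))"
  proof -
    have "1 = exp ((h - a) * m) * exp (- ((h - a) * m))"
      by (simp add: mult_exp_exp)
    also have "\<dots> \<le> exp ((h - a) * m) * sum ?w F"
      using F(3) by simp
    also have "\<dots> = (\<Sum>g\<in>F. exp ((h - a) * m) * ?w g)"
      by (rule sum_distrib_left)
    also have "\<dots> \<le> (\<Sum>g\<in>F. exp (- (a * total_len g)))"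
    proof (rule sum_mono)
      fix g assume "g \<in> F"
      then have "(h - a) * m \<le> (h - a) * total_len g"
        using long F(2) a by (intro mult_left_mono) auto
      then show "exp ((h - a) * m) * ?w g \<le> exp (- (a * total_len g))"
        by (simp add: mult_exp_exp algebra_simps)
    qed
    finally show ?thesis .
  qed
  \<comment> \<open>For \<open>T \<le> M\<close> the empty path alone gives the bound; for
    \<open>T > M\<close> every \<open>T - total_len g\<close> is still positive.\<close>
  define M where "M = Max (insert 1 (total_len ` F))"
  have M: "total_len g \<le> M" if "g \<in> F" for g
    unfolding M_def using F(1) that by (intro Max_ge) auto
  define \<kappa> where "\<kappa> = exp (- (a * M))"
  \<comment> \<open>Each loop has length at least \<open>m\<close>, so prepending one lowers the
    level \<open>n\<close> by one.\<close>
  have "\<kappa> * exp (a * T) \<le> path_count T" if "0 < T" "T \<le> real n * m" for n T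
    using that
  proof (induction n arbitrary: T)
    case (Suc n)
    show ?case
    proof (cases "T \<le> M")
      case True
      then have "a * T \<le> a * M"
        using a(1) by (rule mult_left_mono)
      then have "\<kappa> * exp (a * T) \<le> 1"
        unfolding \<kappa>_def by (simp add: mult_exp_exp)
      then show ?thesis
        using path_count_ge_1[OF Suc.prems(1)] by linarith
    next
      case False
      have "\<kappa> * exp (a * T) \<le> \<kappa> * exp (a * T) * (\<Sum>g\<in>F. exp (- (a * total_len g)))"
        using mult_left_mono[OF supercritical, of "\<kappa> * exp (a * T)"] unfolding \<kappa>_def by simp
      also have "\<dots> = (\<Sum>g\<in>F. \<kappa> * exp (a * (T - total_len g)))"
        by (simp add: sum_distrib_left mult.assoc mult_exp_exp algebra_simps)
      also have "\<dots> \<le> (\<Sum>g\<in>F. path_count (T - total_len g))"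
      proof (rule sum_mono)
        fix g assume g: "g \<in> F"
        show "\<kappa> * exp (a * (T - total_len g)) \<le> path_count (T - total_len g)"
          using M[OF g] False long[of g] g F(2) Suc.prems(2)
          by (intro Suc.IH) (auto simp: algebra_simps)
      qed
      also have "\<dots> \<le> path_count T"
        by (rule path_count_renewal[OF F(1,2)])
      finally show ?thesis .
    qed
  qed simp
  moreover have "\<exists>n. T \<le> real n * m" for T
    using reals_Archimedean3[OF m(1)] by (meson less_imp_le)
  ultimately have "\<kappa> * exp (a * T) \<le> path_count T" if "0 < T" for T
    using that by blast
  moreover have "\<kappa> > 0" by (simp add: \<kappa>_def)
  ultimately show ?thesis by blast
qed

lemma exceptional_paths_negligible:
  assumes h: "len_sum h first_returns = 1" "0 < h" "a < h" and fin: "path_sum y (paths_from G v) < \<infinity>"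
    and B: "\<And>T p. p \<in> B T \<Longrightarrow> p \<in> paths_less T \<and> - (a * T) \<le> sum_list (map y p)"
  shows "((\<lambda>T. real (card (B T)) / path_count T) \<longlongrightarrow> 0) at_top"
proof -
  obtain K where K: "path_sum y (paths_from G v) = ennreal K" "K \<ge> 0"
    using fin by (cases "path_sum y (paths_from G v)" rule: ennreal_cases) auto
  \<comment> \<open>There are at most \<open>K * exp (a * T)\<close> exceptional paths, so any rate
    \<open>b\<close> between \<open>a\<close> and \<open>h\<close> wins; the lower bound also asks
    for a nonnegative rate.\<close>
  obtain b where b: "max a 0 < b" "b < h"
    using dense[of "max a 0" h] h by auto
  obtain \<kappa> where \<kappa>: "\<kappa> > 0" "\<And>T. T > 0 \<Longrightarrow> \<kappa> * exp (b * T) \<le> path_count T"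
    using path_count_lower_bound[OF h(1), of b] b by auto
  show ?thesis
  proof (rule Lim_null_comparison)
    show "\<forall>\<^sub>F T in at_top. norm (real (card (B T)) / path_count T) \<le> K / \<kappa> * exp (- ((b - a) * T))"
      using eventually_gt_at_top[of 0]
    proof eventually_elim
      case (elim T)
      have "path_sum y (B T) \<le> ennreal K"
        unfolding K(1)[symmetric] by (rule path_sum_mono) (use B in \<open>auto simp: paths_less_iff\<close>)
      then have c: "real (card (B T)) \<le> K * exp (a * T)"
        using path_sum_card_bound(2)[of y "B T" K "- (a * T)"] K(2) B by auto
      have "real (card (B T)) / path_count T \<le> (K * exp (a * T)) / (\<kappa> * exp (b * T))"
        using c \<kappa>(1) \<kappa>(2)[OF elim] by (intro frac_le) auto
      also have "\<dots> = K / \<kappa> * exp (- ((b - a) * T))"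
        by (simp add: exp_diff[symmetric] algebra_simps exp_minus divide_simps mult_exp_exp)
      finally show ?case by simp
    qed
    have "((\<lambda>T. exp (- ((b - a) * T))) \<longlongrightarrow> 0) at_top"
      using b by real_asymp
    then show "((\<lambda>T. K / \<kappa> * exp (- ((b - a) * T))) \<longlongrightarrow> 0) at_top"
      by (rule tendsto_mult_right_zero)
  qed
qed

section \<open>The mean cost\<close>

abbreviation cost_bounded :: "('b \<Rightarrow> real) \<Rightarrow> real \<Rightarrow> bool" where
  "cost_bounded c C \<equiv> \<forall>e\<in>arcs G. \<bar>c e\<bar> \<le> C * len e"

lemma total_cost_bound:
  assumes "cost_bounded c C" "set p \<subseteq> arcs G"
  shows "\<bar>sum_list (map c p)\<bar> \<le> C * total_len p"
  using assms(2)
proof (induction p)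
  case (Cons e p)
  then have "\<bar>c e\<bar> \<le> C * len e" "\<bar>sum_list (map c p)\<bar> \<le> C * total_len p"
    using assms(1) by auto
  then show ?case by (simp add: distrib_left)
qed simp

text \<open>Chernoff's method for upper deviations of a cost with mean zero over loops; lower
  deviations follow by applying it to the negated cost.\<close>

lemma deviation_negligible:
  assumes s: "0 < s" "s < h" "len_sum s nonreturning < \<infinity>" "len_sum s first_returns < \<infinity>"
    and h: "len_sum h first_returns = 1"
    and c: "cost_bounded c C" "0 < C"
    and centred: "(\<Sum>\<^sub>\<infinity>p\<in>first_returns. exp (- (h * total_len p)) * sum_list (map c p)) = 0"
    and \<delta>: "0 < \<delta>"
  shows "((\<lambda>T. real (card {p \<in> paths_less T. \<delta> * T < sum_list (map c p)}) / path_count T) \<longlongrightarrow> 0) at_top"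
proof -
  \<comment> \<open>\<open>\<phi> t\<close> is the sum over first-return loops for the tilted weight \<open>y t\<close>; \<open>\<phi> 0 = 1\<close> and \<open>\<phi>' 0 < 0\<close>.\<close>
  define w where "w p = exp (- (h * total_len p))" for p
  define y where "y t e = - (h * len e) + t * (c e - \<delta> / 2 * len e)" for t e
  define d where "d p = sum_list (map c p) - \<delta> / 2 * total_len p" for p
  have sum_y: "sum_list (map (y t) p) = - (h * total_len p) + t * d p" for t p
    by (induction p) (auto simp: y_def d_def algebra_simps)
  define b where "b = C + \<delta> / 2"
  have b: "b > 0" using c(2) \<delta> by (simp add: b_def)
  \<comment> \<open>A tilt of size at most \<open>\<epsilon>\<close> changes the exponent by at most
    \<open>(h - s) * total_len p\<close>, so tilted sums are dominated by sums at
    \<open>s\<close>.\<close>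
  define \<epsilon> where "\<epsilon> = (h - s) / b"
  have \<epsilon>: "\<epsilon> > 0" using b s by (simp add: \<epsilon>_def)
  have d_le: "\<bar>d p\<bar> \<le> b * total_len p" if "set p \<subseteq> arcs G" for p
    using total_cost_bound[OF c(1) that] total_len_nonneg[OF that] \<delta> mult_nonneg_nonneg[of "\<delta> / 2" "total_len p"]
    unfolding d_def b_def distrib_right by linarith
  have wb: "w p * exp (\<epsilon> * (b * total_len p)) = exp (- (s * total_len p))" for p
  proof -
    have "\<epsilon> * (b * total_len p) = (h - s) * total_len p"
      using b by (simp add: \<epsilon>_def)
    then show ?thesis by (simp add: w_def mult_exp_exp algebra_simps)
  qed
  have sm: "(\<lambda>p. w p * exp (\<epsilon> * (b * total_len p))) summable_on first_returns"
    unfolding wb using s(4) unfolding path_sum_finite_iff by simp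
  note moment = exp_moment_deriv[OF _ _ \<epsilon> sm] exp_moment_summable[OF _ _ \<epsilon> sm]
  have w0: "0 \<le> w p" for p by (simp add: w_def)
  have d_le': "\<bar>d p\<bar> \<le> b * total_len p" if "p \<in> first_returns" for p
    using d_le first_returns_arcs that by blast
  have sl: "(\<lambda>p. w p * (\<delta> / 2 * total_len p)) summable_on first_returns"
    by (rule exp_moment_expansion(1)[OF _ _ \<epsilon> sm])
      (use w0 total_len_nonneg[OF first_returns_arcs] \<delta> c(2) in \<open>auto simp: b_def abs_mult distrib_right\<close>)
  obtain g where g: "g \<in> first_returns" using two_first_returns by blast
  have pos: "0 < (\<Sum>\<^sub>\<infinity>p\<in>first_returns. w p * (\<delta> / 2 * total_len p))"
    by (rule infsum_pos[OF sl _ g])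
      (use g \<delta> w0 total_len_nonneg[OF first_returns_arcs] in \<open>auto simp: w_def first_returns_def intro!: mult_pos_pos total_len_pos\<close>)
  have "(\<Sum>\<^sub>\<infinity>p\<in>first_returns. w p * sum_list (map c p)) =
      (\<Sum>\<^sub>\<infinity>p\<in>first_returns. w p * d p + w p * (\<delta> / 2 * total_len p))"
    by (rule infsum_cong) (simp add: d_def algebra_simps)
  also have "\<dots> = (\<Sum>\<^sub>\<infinity>p\<in>first_returns. w p * d p) + (\<Sum>\<^sub>\<infinity>p\<in>first_returns. w p * (\<delta> / 2 * total_len p))"
    by (rule infsum_add[OF exp_moment_expansion(1)[OF _ _ \<epsilon> sm] sl]) (use w0 d_le' in auto)
  finally have neg: "(\<Sum>\<^sub>\<infinity>p\<in>first_returns. w p * d p) < 0"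
    using pos centred by (simp add: w_def)
  define \<phi> where "\<phi> t = (\<Sum>\<^sub>\<infinity>p\<in>first_returns. w p * exp (t * d p))" for t
  have "(\<phi> has_real_derivative (\<Sum>\<^sub>\<infinity>p\<in>first_returns. w p * d p)) (at 0)"
    unfolding \<phi>_def by (rule moment(1)) (use w0 d_le' in auto)
  then obtain r where r: "r > 0" "\<And>t. 0 < t \<Longrightarrow> t < r \<Longrightarrow> \<phi> (0 + t) < \<phi> 0"
    using DERIV_neg_dec_right[OF _ neg] by blast
  \<comment> \<open>Below \<open>r\<close> the tilted first-return sum is less than 1; up to
    \<open>\<epsilon> / 2\<close> it converges.\<close>
  define t where "t = min (r / 2) (\<epsilon> / 2)"
  have t: "0 < t" "t < r" "t \<le> \<epsilon> / 2"
    using r(1) \<epsilon> by (auto simp: t_def)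
  have fin: "len_sum h first_returns < \<infinity>" by (simp add: h)
  have "ennreal (\<phi> 0) = ennreal 1"
    using path_sum_eq_infsum[OF fin] h by (simp add: \<phi>_def w_def)
  then have "\<phi> 0 = 1"
    by (subst (asm) ennreal_inj) (auto simp: \<phi>_def w_def intro: infsum_nonneg)
  with r(2)[of t] t have less: "\<phi> t < 1" by simp
  have exp_y: "exp (sum_list (map (y t) p)) = w p * exp (t * d p)" for p
    by (simp add: sum_y w_def mult_exp_exp)
  have "(\<lambda>p. w p * exp (t * d p)) summable_on first_returns"
    by (rule moment(2)) (use w0 d_le' t in auto)
  then have "path_sum (y t) first_returns < \<infinity>"
    unfolding path_sum_finite_iff exp_y .
  then have "path_sum (y t) first_returns = ennreal (\<phi> t)"
    by (simp add: path_sum_eq_infsum exp_y \<phi>_def)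
  with less have F: "path_sum (y t) first_returns < 1"
    by (simp flip: ennreal_1 add: ennreal_lessI)
  have "path_sum (y t) nonreturning \<le> len_sum s nonreturning"
  proof (rule path_sum_mono_weight)
    fix p assume "p \<in> nonreturning"
    then have p: "set p \<subseteq> arcs G"
      by (auto simp: nonreturning_def dest: paths_from_arcs)
    have "t * d p \<le> t * \<bar>d p\<bar>"
      using t(1) by (intro mult_left_mono) auto
    also have "\<dots> \<le> \<epsilon> * (b * total_len p)"
      using t \<epsilon> d_le[OF p] by (intro mult_mono) auto
    also have "\<dots> = (h - s) * total_len p"
      using b by (simp add: \<epsilon>_def)
    finally show "sum_list (map (y t) p) \<le> sum_list (map (\<lambda>e. - (s * len e)) p)"
      by (simp add: sum_y algebra_simps)
  qed
  then have "path_sum (y t) nonreturning < \<infinity>"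
    using s(3) by (rule le_less_trans)
  with F have yfin: "path_sum (y t) (paths_from G v) < \<infinity>"
    by (rule path_sum_paths_finite)
  show ?thesis
  proof (rule exceptional_paths_negligible[OF h _ _ yfin])
    show "0 < h" using s by simp
    show "h - t * \<delta> / 2 < h" using t \<delta> by simp
    fix T p assume "p \<in> {p \<in> paths_less T. \<delta> * T < sum_list (map c p)}"
    then have p: "p \<in> paths_less T" "\<delta> * T < sum_list (map c p)" by auto
    then have lt: "total_len p < T" by (simp add: paths_less_iff)
    have "h * total_len p \<le> h * T"
      using lt s by (intro mult_left_mono) auto
    \<comment> \<open>The drift term is at most \<open>\<delta> / 2 * T\<close> because the path is
      shorter than \<open>T\<close>, so half of the deviation remains and lowers the exponent from
      \<open>h\<close> to \<open>h - t * \<delta> / 2\<close>.\<close>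
    moreover have "t * (\<delta> * T - \<delta> / 2 * T) \<le> t * d p"
      unfolding d_def using t p(2) lt \<delta> by (intro mult_left_mono diff_mono) auto
    ultimately show "p \<in> paths_less T \<and> - ((h - t * \<delta> / 2) * T) \<le> sum_list (map (y t) p)"
      using p(1) by (simp add: sum_y algebra_simps)
  qed
qed

text \<open>At exponent \<open>h * (1 + \<delta>)\<close> these paths weigh at least
  \<open>exp (- (h * (1 - \<delta>\<^sup>2) * T))\<close>, a rate below \<open>h\<close>. This
  allows \<open>total_len p\<close> to be replaced by \<open>T\<close> in the mean.\<close>

lemma short_paths_negligible:
  assumes h: "0 < h" "len_sum h first_returns = 1" "\<And>\<sigma>. h < \<sigma> \<Longrightarrow> partition_fun \<sigma> v < \<infinity>" and \<delta>: "0 < \<delta>"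
  shows "((\<lambda>T. real (card {p \<in> paths_less T. total_len p \<le> (1 - \<delta>) * T}) / path_count T) \<longlongrightarrow> 0) at_top"
proof (rule exceptional_paths_negligible[OF h(2,1)])
  show "h * (1 - \<delta>\<^sup>2) < h" using h(1) \<delta> by simp
  show "partition_fun (h * (1 + \<delta>)) v < \<infinity>"
    by (rule h(3)) (use h(1) \<delta> in simp)
  fix T p assume p: "p \<in> {p \<in> paths_less T. total_len p \<le> (1 - \<delta>) * T}"
  then have "h * (1 + \<delta>) * total_len p \<le> h * (1 + \<delta>) * ((1 - \<delta>) * T)"
    using h(1) \<delta> by (intro mult_left_mono) auto
  also have "\<dots> = h * (1 - \<delta>\<^sup>2) * T"
    by (simp add: algebra_simps power2_eq_square)
  finally show "p \<in> paths_less T \<and> - (h * (1 - \<delta>\<^sup>2) * T) \<le> sum_list (map (\<lambda>e. - (h * (1 + \<delta>) * len e)) p)"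
    using p by simp
qed

text \<open>Close \<open>e\<close> up to a walk at the root and cut it into loops: the loop
  containing \<open>e\<close> has positive cost, as its other arcs cost at least 0.\<close>

lemma positive_first_return:
  assumes nonneg: "\<And>e. e \<in> arcs G \<Longrightarrow> 0 \<le> c e" and e: "e \<in> arcs G" "(0::real) < c e"
  shows "\<exists>g\<in>first_returns. 0 < sum_list (map c g)"
proof -
  obtain a b where ab: "awalk v a (tail G e)" "awalk (head G e) b v"
    using strongly_connected_walks root e(1) by (meson head_in_verts tail_in_verts)
  then have "awalk v (a @ e # b) v"
    using e(1) by (auto simp: awalk_Cons_iff)
  then obtain gs where gs: "set gs \<subseteq> first_returns" "a @ e # b = concat gs"
    using closed_walk_decomposition by blast
  have "e \<in> set (concat gs)"
    unfolding gs(2)[symmetric] by simp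
  then obtain g where g: "g \<in> first_returns" "e \<in> set g"
    using gs(1) by auto
  then obtain u u' where u: "g = u @ e # u'"
    by (meson split_list)
  have "set g \<subseteq> arcs G" using g(1) by (rule first_returns_arcs)
  then have "0 \<le> sum_list (map c u)" "0 \<le> sum_list (map c u')"
    unfolding u by (auto intro!: sum_list_nonneg nonneg)
  with g(1) u e(2) show ?thesis by (intro bexI[of _ g]) auto
qed

lemma mean_cost_tendsto:
  assumes c: "cost_bounded c C" "0 < C"
  shows "\<exists>\<Lambda>. ((\<lambda>T. (\<Sum>p\<in>paths_less T. sum_list (map c p) / T) / path_count T) \<longlongrightarrow> \<Lambda>) at_top \<and>
    ((\<forall>e\<in>arcs G. 0 \<le> c e) \<and> (\<exists>e\<in>arcs G. c e \<noteq> 0) \<longrightarrow> 0 < \<Lambda>)"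
proof -
  obtain s h where s: "0 < s" "s < h" "len_sum s nonreturning < \<infinity>" "len_sum s first_returns < \<infinity>"
    and h: "len_sum h first_returns = 1" "\<And>\<sigma>. h < \<sigma> \<Longrightarrow> partition_fun \<sigma> v < \<infinity>"
    using growth_rate_exists by blast
  have h0: "0 < h" using s by simp
  let ?c = "\<lambda>p. sum_list (map c p)"
  define w where "w p = exp (- (h * total_len p))" for p
  have w0: "0 < w p" for p by (simp add: w_def)
  \<comment> \<open>The bound with \<open>C + 1\<close> covers both the cost and the length
    itself.\<close>
  have "w p * exp ((h - s) / (C + 1) * ((C + 1) * total_len p)) = exp (- (s * total_len p))" for p
  proof -
    have "(h - s) / (C + 1) * ((C + 1) * total_len p) = (h - s) * total_len p"
      using c(2) by simp
    then show ?thesis by (simp add: w_def mult_exp_exp algebra_simps)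
  qed
  then have sm: "(\<lambda>p. w p * exp ((h - s) / (C + 1) * ((C + 1) * total_len p))) summable_on first_returns"
    using s(4) unfolding path_sum_finite_iff by simp
  have \<epsilon>: "0 < (h - s) / (C + 1)" using s c(2) by simp
  have summ: "(\<lambda>p. w p * f p) summable_on first_returns" if "\<And>p. p \<in> first_returns \<Longrightarrow> \<bar>f p\<bar> \<le> (C + 1) * total_len p" for f
    by (rule exp_moment_expansion(1)[OF _ _ \<epsilon> sm]) (use w0 that in \<open>auto intro: less_imp_le\<close>)
  have len0: "0 \<le> total_len p" and cost: "\<bar>?c p\<bar> \<le> C * total_len p" if "p \<in> first_returns" for p
    using total_len_nonneg total_cost_bound[OF c(1)] first_returns_arcs[OF that] by auto
  have sc: "(\<lambda>p. w p * ?c p) summable_on first_returns"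
    by (rule summ) (use len0 cost in \<open>force simp: distrib_right\<close>)
  have sl: "(\<lambda>p. w p * total_len p) summable_on first_returns"
    by (rule summ) (use len0 c(2) in \<open>auto simp: distrib_right\<close>)
  define \<mu> where "\<mu> = (\<Sum>\<^sub>\<infinity>p\<in>first_returns. w p * total_len p)"
  define \<Lambda> where "\<Lambda> = (\<Sum>\<^sub>\<infinity>p\<in>first_returns. w p * ?c p) / \<mu>"
  obtain g where g: "g \<in> first_returns" using two_first_returns by blast
  have \<mu>: "\<mu> > 0"
    unfolding \<mu>_def
    by (rule infsum_pos[OF sl _ g]) (use g w0 len0 in \<open>auto simp: first_returns_def less_imp_le intro!: mult_pos_pos total_len_pos mult_nonneg_nonneg\<close>)
  \<comment> \<open>Subtracting \<open>\<Lambda> * len e\<close> gives the cost mean zero over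
    first-return loops.\<close>
  define c' where "c' e = c e - \<Lambda> * len e" for e
  define C' where "C' = C + \<bar>\<Lambda>\<bar>"
  have C': "C' > 0" using c(2) by (simp add: C'_def)
  have sum_c': "sum_list (map c' p) = ?c p - \<Lambda> * total_len p" for p
    by (induction p) (auto simp: c'_def algebra_simps)
  have sum_c'': "sum_list (map (\<lambda>e. - c' e) p) = - sum_list (map c' p)" for p
    by (induction p) auto
  have c': "cost_bounded c' C'"
  proof
    fix e assume e: "e \<in> arcs G"
    have "\<bar>c' e\<bar> \<le> \<bar>c e\<bar> + \<bar>\<Lambda>\<bar> * len e"
      unfolding c'_def using abs_triangle_ineq4[of "c e" "\<Lambda> * len e"] len_pos[OF e] by (simp add: abs_mult)
    with c(1) e show "\<bar>c' e\<bar> \<le> C' * len e" by (force simp: C'_def distrib_right)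
  qed
  have centred: "(\<Sum>\<^sub>\<infinity>p\<in>first_returns. exp (- (h * total_len p)) * sum_list (map c' p)) = 0"
  proof -
    have "(\<Sum>\<^sub>\<infinity>p\<in>first_returns. exp (- (h * total_len p)) * sum_list (map c' p)) =
        (\<Sum>\<^sub>\<infinity>p\<in>first_returns. w p * ?c p + (- \<Lambda>) * (w p * total_len p))"
      by (rule infsum_cong) (simp add: sum_c' w_def algebra_simps)
    also have "\<dots> = (\<Sum>\<^sub>\<infinity>p\<in>first_returns. w p * ?c p) + (\<Sum>\<^sub>\<infinity>p\<in>first_returns. (- \<Lambda>) * (w p * total_len p))"
      by (rule infsum_add[OF sc summable_on_cmult_right[OF sl]])
    also have "\<dots> = (\<Sum>\<^sub>\<infinity>p\<in>first_returns. w p * ?c p) + (- \<Lambda>) * \<mu>"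
      unfolding \<mu>_def by (subst infsum_cmult_right) (use sl in auto)
    also have "\<dots> = 0"
      using \<mu> by (simp add: \<Lambda>_def)
    finally show ?thesis .
  qed
  then have centred': "(\<Sum>\<^sub>\<infinity>p\<in>first_returns. exp (- (h * total_len p)) * sum_list (map (\<lambda>e. - c' e) p)) = 0"
    by (simp add: sum_c'' infsum_uminus)
  let ?B1 = "\<lambda>\<delta> T. {p \<in> paths_less T. \<delta> * T < sum_list (map c' p)}"
  let ?B2 = "\<lambda>\<delta> T. {p \<in> paths_less T. \<delta> * T < sum_list (map (\<lambda>e. - c' e) p)}"
  let ?B3 = "\<lambda>\<delta> T. {p \<in> paths_less T. total_len p \<le> (1 - \<delta>) * T}"
  let ?M = "\<lambda>T. (\<Sum>p\<in>paths_less T. ?c p / T) / path_count T"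
  let ?b = "\<lambda>B T. real (card (B T)) / path_count T"
  \<comment> \<open>Outside the three exceptional sets, \<open>c'\<close> contributes at most
    \<open>\<delta>\<close>, and replacing \<open>total_len p\<close> by \<open>T\<close> at most
    \<open>\<bar>\<Lambda>\<bar> * \<delta>\<close>. On them the error is at most \<open>C'\<close>
    per path.\<close>
  have error: "\<bar>?M T - \<Lambda>\<bar> \<le> (1 + \<bar>\<Lambda>\<bar>) * \<delta> + C' * (?b (?B1 \<delta>) T + ?b (?B2 \<delta>) T + ?b (?B3 \<delta>) T)"
    if T: "0 < T" and \<delta>: "0 < \<delta>" "\<delta> < 1" for T \<delta>
  proof -
    let ?i = "\<lambda>B p. indicator (B T) p :: real"
    have N: "path_count T > 0" using path_count_ge_1[OF T] by linarith
    have pt: "\<bar>?c p / T - \<Lambda>\<bar> \<le> (1 + \<bar>\<Lambda>\<bar>) * \<delta> + C' * (?i (?B1 \<delta>) p + ?i (?B2 \<delta>) p + ?i (?B3 \<delta>) p)"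
      if p: "p \<in> paths_less T" for p
    proof (cases "p \<in> ?B1 \<delta> T \<or> p \<in> ?B2 \<delta> T \<or> p \<in> ?B3 \<delta> T")
      case True
      then have "1 \<le> ?i (?B1 \<delta>) p + ?i (?B2 \<delta>) p + ?i (?B3 \<delta>) p"
        by (auto simp: indicator_def)
      then have "C' * 1 \<le> C' * (?i (?B1 \<delta>) p + ?i (?B2 \<delta>) p + ?i (?B3 \<delta>) p)"
        using C' by (intro mult_left_mono) auto
      moreover have "\<bar>?c p / T - \<Lambda>\<bar> \<le> C'"
      proof -
        have a: "set p \<subseteq> arcs G" "total_len p < T"
          using p paths_from_arcs by (auto simp: paths_less_iff)
        have "\<bar>?c p\<bar> \<le> C * total_len p"
          by (rule total_cost_bound[OF c(1) a(1)])
        also have "\<dots> \<le> C * T"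
          using a(2) c(2) by (intro mult_left_mono) auto
        finally have "\<bar>?c p / T\<bar> \<le> C"
          using T by (simp add: field_simps)
        then show ?thesis
          unfolding C'_def by linarith
      qed
      moreover have "0 \<le> (1 + \<bar>\<Lambda>\<bar>) * \<delta>" using \<delta> by simp
      ultimately show ?thesis by linarith
    next
      case False
      then have a: "\<bar>sum_list (map c' p)\<bar> \<le> \<delta> * T" "(1 - \<delta>) * T < total_len p" "total_len p < T"
        using p by (auto simp: sum_c'' paths_less_iff abs_le_iff)
      have "\<bar>?c p - \<Lambda> * T\<bar> \<le> \<bar>sum_list (map c' p)\<bar> + \<bar>\<Lambda> * (T - total_len p)\<bar>"
        unfolding sum_c' right_diff_distrib by linarith
      also have "\<bar>\<Lambda> * (T - total_len p)\<bar> = \<bar>\<Lambda>\<bar> * (T - total_len p)"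
        using a(3) by (simp add: abs_mult)
      also have "\<dots> \<le> \<bar>\<Lambda>\<bar> * (\<delta> * T)"
        using a(2) by (intro mult_left_mono) (auto simp: algebra_simps)
      finally have "\<bar>?c p - \<Lambda> * T\<bar> \<le> (1 + \<bar>\<Lambda>\<bar>) * \<delta> * T"
        using a(1) by (simp add: algebra_simps)
      moreover have "\<bar>?c p / T - \<Lambda>\<bar> = \<bar>?c p - \<Lambda> * T\<bar> / T"
        using T by (simp add: field_simps flip: abs_divide) (simp add: abs_mult)
      ultimately have "\<bar>?c p / T - \<Lambda>\<bar> \<le> (1 + \<bar>\<Lambda>\<bar>) * \<delta>"
        using T by (simp add: pos_divide_le_eq)
      moreover have "?i (?B1 \<delta>) p = 0" "?i (?B2 \<delta>) p = 0" "?i (?B3 \<delta>) p = 0"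
        using False by (simp_all only: de_Morgan_disj indicator_simps not_False_eq_True)
      ultimately show ?thesis by (simp only: add_0_right mult_zero_right)
    qed
    have card_i: "(\<Sum>p\<in>paths_less T. ?i B p) = real (card (B T))" if "B T \<subseteq> paths_less T" for B
    proof -
      have "(\<Sum>p\<in>paths_less T. ?i B p) = (\<Sum>p\<in>B T. ?i B p)"
        by (rule sum.mono_neutral_right) (use that finite_paths_less in auto)
      then show ?thesis by simp
    qed
    have "?M T - \<Lambda> = (\<Sum>p\<in>paths_less T. ?c p / T - \<Lambda>) / path_count T"
      using N by (simp add: sum_subtractf diff_divide_distrib)
    then have "\<bar>?M T - \<Lambda>\<bar> = \<bar>\<Sum>p\<in>paths_less T. ?c p / T - \<Lambda>\<bar> / path_count T"
      using N by simp
    also have "\<dots> \<le> (\<Sum>p\<in>paths_less T. (1 + \<bar>\<Lambda>\<bar>) * \<delta> + C' * (?i (?B1 \<delta>) p + ?i (?B2 \<delta>) p + ?i (?B3 \<delta>) p)) / path_count T"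
      using pt by (intro divide_right_mono order_trans[OF sum_abs] sum_mono) auto
    also have "(\<Sum>p\<in>paths_less T. (1 + \<bar>\<Lambda>\<bar>) * \<delta> + C' * (?i (?B1 \<delta>) p + ?i (?B2 \<delta>) p + ?i (?B3 \<delta>) p)) =
       path_count T * ((1 + \<bar>\<Lambda>\<bar>) * \<delta>) + C' * (real (card (?B1 \<delta> T)) + real (card (?B2 \<delta> T)) + real (card (?B3 \<delta> T)))"
      using card_i[of "?B1 \<delta>"] card_i[of "?B2 \<delta>"] card_i[of "?B3 \<delta>"]
      by (simp add: sum.distrib sum_distrib_left[symmetric])
    also have "\<dots> / path_count T = (1 + \<bar>\<Lambda>\<bar>) * \<delta> + C' * (?b (?B1 \<delta>) T + ?b (?B2 \<delta>) T + ?b (?B3 \<delta>) T)"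
      using N by (simp add: field_simps)
    finally show ?thesis .
  qed
  have "(?M \<longlongrightarrow> \<Lambda>) at_top"
  proof (rule tendstoI)
    fix e :: real assume e: "0 < e"
    define \<delta> where "\<delta> = min (1 / 2) (e / (2 * (1 + \<bar>\<Lambda>\<bar>)))"
    have \<delta>: "0 < \<delta>" "\<delta> < 1" using e by (auto simp: \<delta>_def)
    have "(1 + \<bar>\<Lambda>\<bar>) * \<delta> \<le> (1 + \<bar>\<Lambda>\<bar>) * (e / (2 * (1 + \<bar>\<Lambda>\<bar>)))"
      by (intro mult_left_mono) (auto simp: \<delta>_def)
    also have "\<dots> = e / 2"
      by (simp add: field_simps add_nonneg_eq_0_iff)
    also have "\<dots> < e" using e by simp
    finally have small: "(1 + \<bar>\<Lambda>\<bar>) * \<delta> + C' * (0 + 0 + 0) < e" by simp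
    have "((\<lambda>T. (1 + \<bar>\<Lambda>\<bar>) * \<delta> + C' * (?b (?B1 \<delta>) T + ?b (?B2 \<delta>) T + ?b (?B3 \<delta>) T)) \<longlongrightarrow>
        (1 + \<bar>\<Lambda>\<bar>) * \<delta> + C' * (0 + 0 + 0)) at_top"
      using deviation_negligible[OF s h(1) c' C' centred \<delta>(1)]
        deviation_negligible[OF s h(1) _ C' centred' \<delta>(1)] c' short_paths_negligible[OF h0 h \<delta>(1)]
      by (intro tendsto_intros) auto
    then have "\<forall>\<^sub>F T in at_top. (1 + \<bar>\<Lambda>\<bar>) * \<delta> + C' * (?b (?B1 \<delta>) T + ?b (?B2 \<delta>) T + ?b (?B3 \<delta>) T) < e"
      using small by (rule order_tendstoD)
    then show "\<forall>\<^sub>F T in at_top. dist (?M T) \<Lambda> < e"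
      using eventually_gt_at_top[of 0]
      by eventually_elim (use error[OF _ \<delta>] in \<open>auto simp: dist_real_def intro: le_less_trans\<close>)
  qed
  moreover have "0 < \<Lambda>" if pos: "\<And>e. e \<in> arcs G \<Longrightarrow> 0 \<le> c e" "e \<in> arcs G" "c e \<noteq> 0" for e
  proof -
    obtain g where g: "g \<in> first_returns" "0 < ?c g"
      using positive_first_return[of c e] pos by force
    have "0 \<le> ?c p" if "p \<in> first_returns" for p
      using first_returns_arcs[OF that] by (auto intro!: sum_list_nonneg pos(1))
    then have "0 < (\<Sum>\<^sub>\<infinity>p\<in>first_returns. w p * ?c p)"
      by (intro infsum_pos[OF sc _ g(1)]) (use g w0 in \<open>auto intro!: mult_nonneg_nonneg intro: less_imp_le\<close>)
    then show ?thesis using \<mu> by (simp add: \<Lambda>_def)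
  qed
  ultimately show ?thesis by blast
qed

section \<open>Integration against the path measure\<close>

lemma integral_path_measure:
  fixes f :: "'b awalk \<Rightarrow> real"
  assumes "0 < T"
  shows "(\<integral>p. f p \<partial>path_measure G len v T) = (\<Sum>p\<in>paths_less T. f p) / path_count T"
proof -
  let ?P = "paths_from G v"
  have N: "path_count T > 0" using path_count_ge_1[OF assms] by linarith
  have sub: "paths_less T \<subseteq> ?P" by (auto simp: paths_less_iff)
  have em: "emeasure (count_space ?P) (paths_less T) = ennreal (path_count T)"
    using sub finite_paths_less by (simp add: emeasure_count_space ennreal_of_nat_eq_real_of_nat)
  have "path_measure G len v T = density (count_space ?P) (\<lambda>p. ennreal (indicator (paths_less T) p / path_count T))"
    unfolding path_measure_def uniform_measure_def em
    by (intro arg_cong[where f = "density _"] ext) (use N in \<open>auto simp: indicator_def divide_ennreal simp flip: ennreal_1\<close>)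
  then have "(\<integral>p. f p \<partial>path_measure G len v T) = (\<integral>p. indicator (paths_less T) p / path_count T * f p \<partial>count_space ?P)"
    by (simp only:) (subst integral_real_density, auto)
  also have "\<dots> = (\<Sum>p | p \<in> ?P \<and> indicator (paths_less T) p / path_count T * f p \<noteq> 0. indicator (paths_less T) p / path_count T * f p)"
    by (rule lebesgue_integral_count_space_finite_support)
      (rule finite_subset[OF _ finite_paths_less[of T]], auto simp: indicator_def)
  also have "\<dots> = (\<Sum>p\<in>paths_less T. indicator (paths_less T) p / path_count T * f p)"
    by (rule sum.mono_neutral_left) (use finite_paths_less sub in \<open>auto simp: indicator_def\<close>)
  also have "\<dots> = (\<Sum>p\<in>paths_less T. f p) / path_count T"
    by (simp add: sum_divide_distrib)
  finally show ?thesis .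
qed

end

theorem theorem2p4:
  fixes G :: "('a, 'b) pre_digraph" and len c :: "'b \<Rightarrow> real" and v :: 'a
  assumes "length_digraph G len" and "G1 G len" and "G2 G len" and "G3 G len"
    and "v \<in> verts G"
    and "is_cost G len c"
  shows "(\<forall>T>0. (1 / T) * (\<integral>p. wf_digraph.awalk_cost c p \<partial>path_measure G len v T) =
           (1 / real (card (paths_from_less G len v T))) *
             (\<Sum>p\<in>paths_from_less G len v T. wf_digraph.awalk_cost c p / T)) \<and>
    (\<exists>\<Lambda>::real.
       ((\<lambda>T. (1 / T) * (\<integral>p. wf_digraph.awalk_cost c p \<partial>path_measure G len v T)) \<longlongrightarrow> \<Lambda>) at_top \<and>
       ((\<forall>u p w. pre_digraph.awalk G u p w \<longrightarrow> 0 \<le> wf_digraph.awalk_cost c p) \<and>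
        (\<exists>e\<in>arcs G. c e \<noteq> 0) \<longrightarrow> 0 < \<Lambda>))"
proof -
  interpret length_digraph G len by fact
  interpret rooted_length_digraph G len v
    by unfold_locales (use assms in auto)
  have int: "(1 / T) * (\<integral>p. awalk_cost c p \<partial>path_measure G len v T) =
      (1 / path_count T) * (\<Sum>p\<in>paths_less T. awalk_cost c p / T)" if "T > 0" for T
    using integral_path_measure[OF that, of "awalk_cost c"] by (simp add: sum_divide_distrib[symmetric])
  obtain C where C: "0 < C" "cost_bounded c C"
    using assms(6) unfolding is_cost_def by blast
  obtain \<Lambda> where \<Lambda>: "((\<lambda>T. (\<Sum>p\<in>paths_less T. sum_list (map c p) / T) / path_count T) \<longlongrightarrow> \<Lambda>) at_top"
    "(\<forall>e\<in>arcs G. 0 \<le> c e) \<and> (\<exists>e\<in>arcs G. c e \<noteq> 0) \<longrightarrow> 0 < \<Lambda>"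
    using mean_cost_tendsto[OF C(2,1)] by blast
  have "((\<lambda>T. (1 / T) * (\<integral>p. awalk_cost c p \<partial>path_measure G len v T)) \<longlongrightarrow> \<Lambda>) at_top"
  proof (rule Lim_transform_eventually[OF \<Lambda>(1)])
    show "\<forall>\<^sub>F T in at_top. (\<Sum>p\<in>paths_less T. sum_list (map c p) / T) / path_count T =
        (1 / T) * (\<integral>p. awalk_cost c p \<partial>path_measure G len v T)"
      using eventually_gt_at_top[of 0]
    proof eventually_elim
      case (elim T)
      show ?case unfolding int[OF elim] by (simp add: awalk_cost_def)
    qed
  qed
  moreover have "0 \<le> c e" if "\<forall>u p w. awalk u p w \<longrightarrow> 0 \<le> awalk_cost c p" "e \<in> arcs G" for e
  proof -
    have "0 \<le> awalk_cost c [e]"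
      using that(1) arc_implies_awalk[OF that(2)] by blast
    then show ?thesis by simp
  qed
  ultimately show ?thesis
    using int \<Lambda>(2) by blast
qed

end
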